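(* The set $\{r_{\Lambda}\mid\Lambda\text{ is a superpartition}\}$ is a basis of the $\mathbb Q$-vector space $\mathbf{sSym}$.
   Context: Let $\mathbb N=\{1,2,\ldots\}$ and $\dot{\mathbb N}_0=\{\dot0,\dot1,\dot2,\ldots\}$ (dotted copies of the nonnegative integers). A dotted composition is a finite tuple $\alpha=(\alpha_1,\ldots,\alpha_k)$ with entries in $\mathbb N\cup\dot{\mathbb N}_0$. For entries not both dotted put $m\oplus n=m+n$ and $m\oplus\dot n=\dot m\oplus n=\dot r$ with $r=m+n$. The partial order $\preceq$ on dotted compositions is the reflexive-transitive closure of the relation: $\beta$ is obtained from $\alpha$ by replacing two consecutive entries $x,y$ of $\alpha$ that are not both dotted by the single entry $x\oplus y$ (then $\alpha\preceq\beta$). $\mathbf{sNSym}$, as an algebra, is the free associative unital $\mathbb Q$-algebra on generators $H_n$ ($n\in\mathbb N$) and $H_{\dot n}=\tilde H_n$ ($n\ge0$); $H_\alpha:=H_{\alpha_1}\cdots H_{\alpha_k}$. The noncommutative Ribbon Schur functions in superspace are defined recursively by $R_\alpha=H_\alpha-\sum_{\alpha\prec\beta}R_\beta$. A superpartition is a pair $\Lambda=(\Lambda_1,\ldots,\Lambda_m;\Lambda_{m+1},\ldots,\Lambda_n)$ of integer sequences with $\Lambda_1>\cdots>\Lambda_m\ge0$ and $\Lambda_{m+1}\ge\cdots\ge\Lambda_n\ge1$; $\mathrm{df}(\Lambda)=m$ and $|\Lambda|=\Lambda_1+\cdots+\Lambda_n$. It is identified with the dotted composition $(\dot\Lambda_1,\ldots,\dot\Lambda_m,\Lambda_{m+1},\ldots,\Lambda_n)$.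 Let $x=(x_1,x_2,\ldots)$ be commuting variables and $\theta=(\theta_1,\theta_2,\ldots)$ anticommuting variables ($\theta_i\theta_j=-\theta_j\theta_i$, $\theta_i^2=0$), the $\theta$'s commuting with the $x$'s. $\mathbf{sSym}$ is the $\mathbb Q$-algebra of symmetric functions in superspace: bounded-degree formal power series in $x,\theta$ invariant under all simultaneous permutations of the $x_i$ and $\theta_i$. It has the monomial basis $m_\Lambda$, the sum of all distinct terms $\theta_{i_1}\cdots\theta_{i_m}x_{i_1}^{\Lambda_1}\cdots x_{i_n}^{\Lambda_n}$ with $i_1,\ldots,i_n$ pairwise distinct. Put $h_r=\sum_{|\Lambda|=r,\,\mathrm{df}(\Lambda)=0}m_\Lambda$ ($r\ge1$) and $\tilde h_k=\sum_{|\Lambda|=k,\,\mathrm{df}(\Lambda)=1}(\Lambda_1+1)m_\Lambda$ ($k\ge0$). $\pi:\mathbf{sNSym}\to\mathbf{sSym}$ is the algebra morphism with $\pi(H_n)=h_n$ and $\pi(\tilde H_n)=\tilde h_n$. The Ribbon Schur function in superspace indexed by a dotted composition $\alpha$ is $r_\alpha:=\pi(R_\alpha)$. *)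

theory Defs
  imports Complex_Main "HOL-Library.Poly_Mapping"
begin

text \<open>
  Entries of dotted compositions: the pair \<open>(n, False)\<close> is the positive integer \<open>n\<close>, and \<open>(n, True)\<close>
  is the dotted nonnegative integer \<open>n\<close>.
\<close>

typedef dpart = "{(n :: nat, d :: bool). d \<or> 1 \<le> n}"
  by (intro exI[of _ "(1, False)"]) simp

setup_lifting type_definition_dpart

lift_definition pval :: "dpart \<Rightarrow> nat" is fst .

lift_definition is_dotted :: "dpart \<Rightarrow> bool" is snd .

lift_definition dotted :: "nat \<Rightarrow> dpart" is "\<lambda>n. (n, True)" by simp

text \<open>Only meaningful for \<open>n \<ge> 1\<close>.\<close>

definition undotted :: "nat \<Rightarrow> dpart" where
  "undotted n = Abs_dpart (n, False)"

lemma pval_dotted [simp]: "pval (dotted n) = n" and is_dotted_dotted [simp]: "is_dotted (dotted n)"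
  by (transfer, simp)+

lemma pval_undotted [simp]: "1 \<le> n \<Longrightarrow> pval (undotted n) = n"
  and is_dotted_undotted [simp]: "1 \<le> n \<Longrightarrow> \<not> is_dotted (undotted n)"
  by (simp_all add: undotted_def pval.rep_eq is_dotted.rep_eq Abs_dpart_inverse)

lemma dpart_eqI: "pval p = pval q \<Longrightarrow> is_dotted p = is_dotted q \<Longrightarrow> p = q"
  by transfer auto

lemma dpart_cases:
  obtains (dotted) n where "p = dotted n" | (undotted) n where "1 \<le> n" "p = undotted n"
proof (cases "is_dotted p")
  case True
  then have "p = dotted (pval p)" by (intro dpart_eqI) simp_all
  then show ?thesis by (rule dotted)
next
  case False
  then have "1 \<le> pval p" by transfer auto
  moreover from this False have "p = undotted (pval p)" by (intro dpart_eqI) simp_all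
  ultimately show ?thesis by (rule undotted)
qed

text \<open>Only used when the two entries are not both dotted.\<close>

lift_definition oplus :: "dpart \<Rightarrow> dpart \<Rightarrow> dpart" (infixl \<open>\<oplus>\<close> 65)
  is "\<lambda>(m, c) (n, d). (m + n, c \<or> d)" by auto

text \<open>
  The dotted compositions form the free monoid on the entries; hence their monoid algebra
  \<open>snsym\<close> is the free associative algebra on the generators indexed by the entries.
\<close>

datatype dcomp = DComp (entries: "dpart list")

instantiation dcomp :: monoid_add
begin

definition zero_dcomp :: dcomp where "0 = DComp []"

definition plus_dcomp :: "dcomp \<Rightarrow> dcomp \<Rightarrow> dcomp" where
  "\<alpha> + \<beta> = DComp (entries \<alpha> @ entries \<beta>)"

instance by standard (simp_all add: zero_dcomp_def plus_dcomp_def)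

end

inductive merge_step :: "dcomp \<Rightarrow> dcomp \<Rightarrow> bool" where
  "\<not> (is_dotted p \<and> is_dotted q) \<Longrightarrow> merge_step (DComp (us @ [p, q] @ vs)) (DComp (us @ [p \<oplus> q] @ vs))"

definition dcomp_le :: "dcomp \<Rightarrow> dcomp \<Rightarrow> bool" (infix \<open>\<preceq>\<close> 50) where
  "\<alpha> \<preceq> \<beta> \<longleftrightarrow> merge_step\<^sup>*\<^sup>* \<alpha> \<beta>"

definition dcomp_less :: "dcomp \<Rightarrow> dcomp \<Rightarrow> bool" (infix \<open>\<prec>\<close> 50) where
  "\<alpha> \<prec> \<beta> \<longleftrightarrow> \<alpha> \<preceq> \<beta> \<and> \<alpha> \<noteq> \<beta>"

lemma merge_step_length: "merge_step \<alpha> \<beta> \<Longrightarrow> length (entries \<alpha>) = Suc (length (entries \<beta>))"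
  by (auto elim!: merge_step.cases)

lemma dcomp_le_cases: "\<alpha> \<preceq> \<beta> \<Longrightarrow> \<alpha> = \<beta> \<or> length (entries \<beta>) < length (entries \<alpha>)"
  unfolding dcomp_le_def by (induction rule: rtranclp_induct) (auto dest: merge_step_length)

lemma dcomp_less_length: "\<alpha> \<prec> \<beta> \<Longrightarrow> length (entries \<beta>) < length (entries \<alpha>)"
  using dcomp_le_cases unfolding dcomp_less_def by blast

lemma finite_merge_step: "finite {\<beta>. merge_step \<alpha> \<beta>}"
proof -
  have "{\<beta>. merge_step \<alpha> \<beta>} \<subseteq> (\<lambda>k. DComp (take k (entries \<alpha>) @
      [entries \<alpha> ! k \<oplus> entries \<alpha> ! Suc k] @ drop (Suc (Suc k)) (entries \<alpha>))) ` {..length (entries \<alpha>)}"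
  proof
    fix \<beta> assume "\<beta> \<in> {\<beta>. merge_step \<alpha> \<beta>}"
    then have "merge_step \<alpha> \<beta>" by simp
    then show "\<beta> \<in> (\<lambda>k. DComp (take k (entries \<alpha>) @
      [entries \<alpha> ! k \<oplus> entries \<alpha> ! Suc k] @ drop (Suc (Suc k)) (entries \<alpha>))) ` {..length (entries \<alpha>)}"
    proof cases
      case (1 p q us vs)
      then show ?thesis by (intro image_eqI[of _ _ "length us"]) (auto simp: nth_append)
    qed
  qed
  then show ?thesis by (rule finite_subset) simp
qed

lemma finite_dcomp_above: "finite {\<beta>. \<alpha> \<preceq> \<beta>}"
proof (induction "length (entries \<alpha>)" arbitrary: \<alpha> rule: less_induct)
  case less
  have "{\<beta>. \<alpha> \<preceq> \<beta>} \<subseteq> insert \<alpha> (\<Union>\<gamma>\<in>{\<gamma>. merge_step \<alpha> \<gamma>}. {\<beta>. \<gamma> \<preceq> \<beta>})"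
    by (auto simp: dcomp_le_def elim: converse_rtranclpE)
  moreover have "finite {\<beta>. \<gamma> \<preceq> \<beta>}" if "merge_step \<alpha> \<gamma>" for \<gamma>
    using less[of \<gamma>] merge_step_length[OF that] by simp
  ultimately show ?case
    using finite_merge_step[of \<alpha>] by (auto intro: finite_subset)
qed

lemma finite_dcomp_strictly_above: "finite {\<beta>. \<alpha> \<prec> \<beta>}"
  by (rule finite_subset[OF _ finite_dcomp_above[of \<alpha>]]) (auto simp: dcomp_less_def)

type_synonym snsym = "dcomp \<Rightarrow>\<^sub>0 rat"

definition gen_H :: "dpart \<Rightarrow> snsym" where
  "gen_H p = Poly_Mapping.single (DComp [p]) 1"

definition H :: "dcomp \<Rightarrow> snsym" where
  "H \<alpha> = prod_list (map gen_H (entries \<alpha>))"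

lemma H_eq_single: "H \<alpha> = Poly_Mapping.single \<alpha> 1"
proof -
  have "prod_list (map gen_H ps) = Poly_Mapping.single (DComp ps) 1" for ps
  proof (induction ps)
    case Nil
    show ?case by (simp flip: zero_dcomp_def)
  next
    case (Cons p ps)
    then show ?case by (simp add: gen_H_def mult_single plus_dcomp_def)
  qed
  then show ?thesis by (simp add: H_def)
qed

function ribbon_R :: "dcomp \<Rightarrow> snsym" where
  "ribbon_R \<alpha> = H \<alpha> - (\<Sum>\<beta>\<in>{\<beta>. \<alpha> \<prec> \<beta>}. ribbon_R \<beta>)"
  by pat_completeness auto
termination
  by (relation "measure (length \<circ> entries)") (auto dest: dcomp_less_length)

declare ribbon_R.simps [simp del]

text \<open>
  The variables \<open>x\<^sub>i\<close> and \<open>\<theta>\<^sub>i\<close> are indexed by \<open>i :: nat\<close>, starting from \<open>0\<close>.  The number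
  \<open>coeff f I e\<close> is the coefficient of \<open>\<theta>\<^bsub>i\<^sub>1\<^esub> \<cdots> \<theta>\<^bsub>i\<^sub>m\<^esub> x\<^sup>e\<close>, where \<open>I = {i\<^sub>1 < \<cdots> < i\<^sub>m}\<close>.
\<close>

typedef superseries = "{f :: nat set \<Rightarrow> (nat \<Rightarrow>\<^sub>0 nat) \<Rightarrow> rat. \<forall>I e. infinite I \<longrightarrow> f I e = 0}"
  morphisms coeff Abs_superseries
  by (intro exI[of _ "\<lambda>_ _. 0"]) simp

setup_lifting type_definition_superseries

lifting_forget poly_mapping.lifting

lemma superseries_eqI: "(\<And>I e. finite I \<Longrightarrow> coeff f I e = coeff g I e) \<Longrightarrow> f = g"
  by transfer (metis ext mem_Collect_eq)

lemma coeff_infinite [simp]: "infinite I \<Longrightarrow> coeff f I e = 0"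
  by transfer simp

text \<open>
  The sign produced by sorting \<open>\<theta>\<^sub>J \<theta>\<^sub>K\<close> for disjoint \<open>J\<close>, \<open>K\<close>: one factor \<open>-1\<close> for each inversion.
\<close>

definition shuffle_sign :: "nat set \<Rightarrow> nat set \<Rightarrow> rat" where
  "shuffle_sign J K = (\<Prod>j\<in>J. \<Prod>k\<in>K. if k < j then - 1 else 1)"

definition factorizations ::
    "nat set \<Rightarrow> (nat \<Rightarrow>\<^sub>0 nat) \<Rightarrow> ((nat set \<times> (nat \<Rightarrow>\<^sub>0 nat)) \<times> (nat set \<times> (nat \<Rightarrow>\<^sub>0 nat))) set" where
  "factorizations I e = {((J, a), (K, b)). J \<inter> K = {} \<and> J \<union> K = I \<and> a + b = e}"

lemma finite_le_exponents: "finite {a :: nat \<Rightarrow>\<^sub>0 nat. \<exists>b. a + b = e}"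
proof -
  let ?K = "Poly_Mapping.keys e"
  let ?B = "{..sum (Poly_Mapping.lookup e) ?K}"
  have "Poly_Mapping.lookup ` {a. \<exists>b. a + b = e} \<subseteq>
      {f. \<forall>i. (i \<in> ?K \<longrightarrow> f i \<in> ?B) \<and> (i \<notin> ?K \<longrightarrow> f i = 0)}"
  proof (clarify, intro conjI impI)
    fix a b :: "nat \<Rightarrow>\<^sub>0 nat" and i
    have le: "Poly_Mapping.lookup a i \<le> Poly_Mapping.lookup (a + b) i" by (simp add: lookup_add)
    {
      assume "i \<in> Poly_Mapping.keys (a + b)"
      then have "Poly_Mapping.lookup (a + b) i \<le>
          sum (Poly_Mapping.lookup (a + b)) (Poly_Mapping.keys (a + b))"
        by (intro member_le_sum) auto
      with le show "Poly_Mapping.lookup a i \<in>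
          {..sum (Poly_Mapping.lookup (a + b)) (Poly_Mapping.keys (a + b))}"
        by simp
    }
    show "Poly_Mapping.lookup a i = 0" if "i \<notin> Poly_Mapping.keys (a + b)"
      using that le by (simp add: in_keys_iff)
  qed
  then have "finite (Poly_Mapping.lookup ` {a. \<exists>b. a + b = e})"
    by (rule finite_subset) (intro finite_set_of_finite_funs; simp)
  then show ?thesis
    by (rule finite_imageD) (auto simp: inj_on_def intro: poly_mapping_eqI)
qed

lemma finite_factorizations:
  assumes "finite I" shows "finite (factorizations I e)"
proof -
  have "factorizations I e \<subseteq>
      (Pow I \<times> {a. \<exists>b. a + b = e}) \<times> (Pow I \<times> {a. \<exists>b. a + b = e})"
    by (auto simp: factorizations_def) (metis add.commute)+
  then show ?thesis
    by (rule finite_subset) (intro finite_cartesian_product finite_le_exponents; simp add: assms)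
qed

lemma shuffle_sign_Un_left:
  "finite I \<Longrightarrow> finite J \<Longrightarrow> I \<inter> J = {} \<Longrightarrow>
    shuffle_sign (I \<union> J) K = shuffle_sign I K * shuffle_sign J K"
  by (simp add: shuffle_sign_def prod.union_disjoint)

lemma shuffle_sign_Un_right:
  "finite J \<Longrightarrow> finite K \<Longrightarrow> J \<inter> K = {} \<Longrightarrow>
    shuffle_sign I (J \<union> K) = shuffle_sign I J * shuffle_sign I K"
  by (simp add: shuffle_sign_def prod.union_disjoint prod.distrib)

lemma shuffle_sign_empty [simp]: "shuffle_sign {} K = 1" "shuffle_sign J {} = 1"
  by (simp_all add: shuffle_sign_def)

instantiation superseries :: ring_1
begin

lift_definition zero_superseries :: superseries is "\<lambda>_ _. 0" by simp

lift_definition one_superseries :: superseries is "\<lambda>I e. if I = {} \<and> e = 0 then 1 else 0" by auto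

lift_definition plus_superseries :: "superseries \<Rightarrow> superseries \<Rightarrow> superseries"
  is "\<lambda>f g I e. f I e + g I e" by simp

lift_definition minus_superseries :: "superseries \<Rightarrow> superseries \<Rightarrow> superseries"
  is "\<lambda>f g I e. f I e - g I e" by simp

lift_definition uminus_superseries :: "superseries \<Rightarrow> superseries" is "\<lambda>f I e. - f I e" by simp

lift_definition times_superseries :: "superseries \<Rightarrow> superseries \<Rightarrow> superseries"
  is "\<lambda>f g I e. \<Sum>((J, a), (K, b))\<in>factorizations I e. shuffle_sign J K * f J a * g K b"
  by (auto simp: factorizations_def intro!: sum.neutral)

instance proof
  fix f g h :: superseries
  show "(f * g) * h = f * (g * h)"
  proof (rule superseries_eqI)
    fix I :: "nat set" and e :: "nat \<Rightarrow>\<^sub>0 nat" assume I: "finite I"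
    let ?F = factorizations
    have fin: "finite L" "finite K" if "((L, c), (K, b)) \<in> ?F I e" for L c K b
      using that I by (auto simp: factorizations_def)
    have L: "coeff ((f * g) * h) I e = (\<Sum>(((L, c), (K, b)), ((J1, a1), (J2, a2)))\<in>
        Sigma (?F I e) (\<lambda>((L, c), _). ?F L c).
        shuffle_sign L K * (shuffle_sign J1 J2 * coeff f J1 a1 * coeff g J2 a2) * coeff h K b)"
      (is "_ = sum ?l ?SL")
    proof -
      have "coeff ((f * g) * h) I e = (\<Sum>u\<in>?F I e. \<Sum>v\<in>(\<lambda>((L, c), _). ?F L c) u. ?l (u, v))"
        by (auto simp: times_superseries.rep_eq sum_distrib_left sum_distrib_right split_def
            intro!: sum.cong)
      also have "\<dots> = sum ?l ?SL"
        by (subst sum.Sigma) (auto intro!: finite_factorizations I dest: fin)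
      finally show ?thesis .
    qed
    have R: "coeff (f * (g * h)) I e = (\<Sum>(((J, a), (L, c)), ((K1, b1), (K2, b2)))\<in>
        Sigma (?F I e) (\<lambda>(_, (L, c)). ?F L c).
        shuffle_sign J L * coeff f J a * (shuffle_sign K1 K2 * coeff g K1 b1 * coeff h K2 b2))"
      (is "_ = sum ?r ?SR")
    proof -
      have "coeff (f * (g * h)) I e = (\<Sum>u\<in>?F I e. \<Sum>v\<in>(\<lambda>(_, (L, c)). ?F L c) u. ?r (u, v))"
        by (auto simp: times_superseries.rep_eq sum_distrib_left sum_distrib_right split_def
            intro!: sum.cong)
      also have "\<dots> = sum ?r ?SR"
        by (subst sum.Sigma) (auto intro!: finite_factorizations I dest: fin)
      finally show ?thesis .
    qed
    have "sum ?l ?SL = sum ?r ?SR"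
    proof (rule sum.reindex_bij_witness[where
          i = "\<lambda>(((J, a), (L, c)), ((K1, b1), (K2, b2))). (((J \<union> K1, a + b1), (K2, b2)), ((J, a), (K1, b1)))"
          and j = "\<lambda>(((L, c), (K, b)), ((J1, a1), (J2, a2))). (((J1, a1), (J2 \<union> K, a2 + b)), ((J2, a2), (K, b)))"], goal_cases)
      case (5 z)
      then obtain K b J1 a1 J2 a2 where z: "z = (((J1 \<union> J2, a1 + a2), (K, b)), ((J1, a1), (J2, a2)))"
        and d: "J1 \<inter> J2 = {}" "(J1 \<union> J2) \<inter> K = {}" "J1 \<union> J2 \<union> K = I"
        by (auto simp: factorizations_def)
      have "finite J1" "finite J2" "finite K" using d I by auto
      then have "shuffle_sign (J1 \<union> J2) K * shuffle_sign J1 J2 = shuffle_sign J1 (J2 \<union> K) * shuffle_sign J2 K"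
        using shuffle_sign_Un_left[of J1 J2 K] shuffle_sign_Un_right[of J2 K J1] d
        by (simp add: Int_Un_distrib2)
      then show ?case
        by (simp add: z algebra_simps)
    qed (auto simp: factorizations_def add.assoc)
    then show "coeff ((f * g) * h) I e = coeff (f * (g * h)) I e"
      by (simp only: L R)
  qed
  show "(f + g) * h = f * h + g * h"
    by (rule superseries_eqI)
      (simp add: times_superseries.rep_eq plus_superseries.rep_eq split_def algebra_simps sum.distrib)
  show "f * (g + h) = f * g + f * h"
    by (rule superseries_eqI)
      (simp add: times_superseries.rep_eq plus_superseries.rep_eq split_def algebra_simps sum.distrib)
  show "1 * f = f"
  proof (rule superseries_eqI)
    fix I :: "nat set" and e :: "nat \<Rightarrow>\<^sub>0 nat" assume "finite I"
    then have "coeff (1 * f) I e = (\<Sum>((J, a), (K, b))\<in>{(({}, 0), (I, e))}. shuffle_sign J K *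
        coeff 1 J a * coeff f K b)"
      unfolding times_superseries.rep_eq
      by (intro sum.mono_neutral_right finite_factorizations)
        (auto simp: factorizations_def one_superseries.rep_eq split: if_splits)
    then show "coeff (1 * f) I e = coeff f I e" by (simp add: one_superseries.rep_eq)
  qed
  show "f * 1 = f"
  proof (rule superseries_eqI)
    fix I :: "nat set" and e :: "nat \<Rightarrow>\<^sub>0 nat" assume "finite I"
    then have "coeff (f * 1) I e = (\<Sum>((J, a), (K, b))\<in>{((I, e), ({}, 0))}. shuffle_sign J K *
        coeff f J a * coeff 1 K b)"
      unfolding times_superseries.rep_eq
      by (intro sum.mono_neutral_right finite_factorizations)
        (auto simp: factorizations_def one_superseries.rep_eq split: if_splits)
    then show "coeff (f * 1) I e = coeff f I e" by (simp add: one_superseries.rep_eq)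
  qed
  show "(0 :: superseries) \<noteq> 1"
    by transfer (auto simp: fun_eq_iff)
qed (transfer, auto simp: fun_eq_iff)+

end

lift_definition scale :: "rat \<Rightarrow> superseries \<Rightarrow> superseries" is "\<lambda>c f I e. c * f I e" by simp

interpretation superspace: vector_space scale
  by standard (transfer, auto simp: fun_eq_iff algebra_simps)+

lemma scale_mult_left: "scale c f * g = scale c (f * g)"
  by (rule superseries_eqI) (simp add: times_superseries.rep_eq scale.rep_eq split_def
      sum_distrib_left algebra_simps)

lemma scale_mult_right: "f * scale c g = scale c (f * g)"
  by (rule superseries_eqI) (simp add: times_superseries.rep_eq scale.rep_eq split_def
      sum_distrib_left algebra_simps)

text \<open>The monomial \<open>\<theta>\<^sub>I x\<^sup>e\<close>, with the \<open>\<theta>\<^sub>i\<close> in increasing order; zero if \<open>I\<close> is infinite.\<close>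

lift_definition smonom :: "nat set \<Rightarrow> (nat \<Rightarrow>\<^sub>0 nat) \<Rightarrow> superseries"
  is "\<lambda>J a I e. if finite I \<and> I = J \<and> e = a then 1 else 0" by auto

definition theta :: "nat \<Rightarrow> superseries" where
  "theta i = smonom {i} 0"

definition xvar :: "nat \<Rightarrow> superseries" where
  "xvar i = smonom {} (Poly_Mapping.single i 1)"

lemma smonom_one: "smonom {} 0 = 1"
  by transfer (auto simp: fun_eq_iff)

lemma smonom_mult:
  assumes "finite J" "finite K"
  shows "smonom J a * smonom K b =
    (if J \<inter> K = {} then scale (shuffle_sign J K) (smonom (J \<union> K) (a + b)) else 0)"
proof (rule superseries_eqI)
  fix I :: "nat set" and e :: "nat \<Rightarrow>\<^sub>0 nat" assume I: "finite I"
  have "coeff (smonom J a * smonom K b) I e =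
      (\<Sum>((J', a'), (K', b'))\<in>factorizations I e \<inter> {((J, a), (K, b))}.
        shuffle_sign J' K' * coeff (smonom J a) J' a' * coeff (smonom K b) K' b')"
    unfolding times_superseries.rep_eq
    by (intro sum.mono_neutral_right finite_factorizations I)
      (auto simp: smonom.rep_eq split: if_splits)
  then show "coeff (smonom J a * smonom K b) I e = coeff (if J \<inter> K = {}
      then scale (shuffle_sign J K) (smonom (J \<union> K) (a + b)) else 0) I e"
    using assms I by (auto simp: smonom.rep_eq scale.rep_eq zero_superseries.rep_eq factorizations_def)
qed

lemma theta_anticommute: "theta i * theta j = - (theta j * theta i)"
  by (cases i j rule: linorder_cases)
    (auto simp: theta_def smonom_mult shuffle_sign_def insert_commute superspace.scale_minus_left)

lemma theta_square: "theta i * theta i = 0"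
  by (simp add: theta_def smonom_mult)

lemma xvar_commute: "xvar i * xvar j = xvar j * xvar i"
  by (simp add: xvar_def smonom_mult add.commute)

lemma xvar_theta_commute: "xvar i * theta j = theta j * xvar i"
  by (simp add: xvar_def theta_def smonom_mult)

text \<open>
  The simultaneous substitution \<open>x\<^sub>i \<mapsto> x\<^bsub>\<sigma>(i)\<^esub>\<close>, \<open>\<theta>\<^sub>i \<mapsto> \<theta>\<^bsub>\<sigma>(i)\<^esub>\<close> for a bijection \<open>\<sigma>\<close>.  It sends
  \<open>\<theta>\<^sub>J x\<^sup>a\<close> to \<open>perm_sign \<sigma> J\<close> times \<open>\<theta>\<^bsub>\<sigma>(J)\<^esub> x\<^sup>b\<close> with \<open>b \<circ> \<sigma> = a\<close>; the sign comes from sorting the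
  \<open>\<theta>\<^bsub>\<sigma>(j)\<^esub>\<close>.
\<close>

definition perm_sign :: "(nat \<Rightarrow> nat) \<Rightarrow> nat set \<Rightarrow> rat" where
  "perm_sign \<sigma> J = (\<Prod>i\<in>J. \<Prod>j\<in>J. if i < j \<and> \<sigma> j < \<sigma> i then - 1 else 1)"

lift_definition permute :: "(nat \<Rightarrow> nat) \<Rightarrow> superseries \<Rightarrow> superseries"
  is "\<lambda>\<sigma> f I e. if finite I
    then perm_sign \<sigma> (\<sigma> -` I) * f (\<sigma> -` I) (Poly_Mapping.map_key \<sigma> e) else 0" by simp

lemma perm_sign_Un:
  assumes "bij \<sigma>" "finite J" "finite K" "J \<inter> K = {}"
  shows "perm_sign \<sigma> (J \<union> K) * shuffle_sign J K =
    shuffle_sign (\<sigma> ` J) (\<sigma> ` K) * perm_sign \<sigma> J * perm_sign \<sigma> K"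
proof -
  define c :: "nat \<Rightarrow> nat \<Rightarrow> rat" where "c i j = (if i < j \<and> \<sigma> j < \<sigma> i then - 1 else 1)" for i j
  have inj: "inj \<sigma>" using assms(1) by (rule bij_is_inj)
  have "perm_sign \<sigma> (J \<union> K) = perm_sign \<sigma> J * perm_sign \<sigma> K *
      ((\<Prod>j\<in>J. \<Prod>k\<in>K. c j k) * (\<Prod>k\<in>K. \<Prod>j\<in>J. c k j))"
    using assms by (simp add: perm_sign_def prod.union_disjoint prod.distrib mult_ac flip: c_def)
  also have "(\<Prod>k\<in>K. \<Prod>j\<in>J. c k j) = (\<Prod>j\<in>J. \<Prod>k\<in>K. c k j)"
    by (rule prod.swap)
  finally have "perm_sign \<sigma> (J \<union> K) * shuffle_sign J K = perm_sign \<sigma> J * perm_sign \<sigma> K *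
      (\<Prod>j\<in>J. \<Prod>k\<in>K. c j k * c k j * (if k < j then - 1 else 1))"
    by (simp add: shuffle_sign_def prod.distrib mult_ac)
  also have "(\<Prod>j\<in>J. \<Prod>k\<in>K. c j k * c k j * (if k < j then - 1 else 1)) =
      (\<Prod>j\<in>J. \<Prod>k\<in>K. if \<sigma> k < \<sigma> j then - 1 else 1)"
  proof (intro prod.cong refl)
    fix j k assume "j \<in> J" "k \<in> K"
    then have "j \<noteq> k" "\<sigma> j \<noteq> \<sigma> k" using assms(4) inj by (auto dest: injD)
    then show "c j k * c k j * (if k < j then - 1 else 1) = (if \<sigma> k < \<sigma> j then - 1 else 1)"
      by (auto simp: c_def)
  qed
  also have "\<dots> = shuffle_sign (\<sigma> ` J) (\<sigma> ` K)"
    using inj by (simp add: shuffle_sign_def prod.reindex inj_on_subset)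
  finally show ?thesis by (simp add: mult_ac)
qed

lemma permute_mult:
  assumes \<sigma>: "bij \<sigma>" shows "permute \<sigma> (f * g) = permute \<sigma> f * permute \<sigma> g"
proof (rule superseries_eqI)
  fix I :: "nat set" and e :: "nat \<Rightarrow>\<^sub>0 nat" assume I: "finite I"
  let ?m = "Poly_Mapping.map_key :: (nat \<Rightarrow> nat) \<Rightarrow> (nat \<Rightarrow>\<^sub>0 nat) \<Rightarrow> nat \<Rightarrow>\<^sub>0 nat"
  define \<tau> where "\<tau> = inv \<sigma>"
  have inj: "inj \<sigma>" "inj \<tau>"
    using \<sigma> by (simp_all add: \<tau>_def bij_is_inj bij_imp_bij_inv)
  have st: "\<sigma> (\<tau> i) = i" "\<tau> (\<sigma> i) = i" for i
    using \<sigma> by (simp_all add: \<tau>_def bij_is_surj surj_f_inv_f bij_is_inj inv_f_f)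
  have v: "\<sigma> -` (\<sigma> ` J) = J" "\<sigma> ` (\<sigma> -` J) = J" for J
    using \<sigma> by (simp_all add: bij_is_inj inj_vimage_image_eq bij_is_surj surj_image_vimage_eq)
  have lk: "Poly_Mapping.lookup (?m \<sigma> a) i = Poly_Mapping.lookup a (\<sigma> i)" "Poly_Mapping.lookup (?m \<tau> a) i = Poly_Mapping.lookup a (\<tau> i)" for a i
    using inj by (simp_all add: map_key.rep_eq)
  have m: "?m \<sigma> (?m \<tau> a) = a" "?m \<tau> (?m \<sigma> a) = a" "?m \<sigma> (a + b) = ?m \<sigma> a + ?m \<sigma> b"
      "?m \<tau> (a + b) = ?m \<tau> a + ?m \<tau> b" for a b
    by (auto intro!: poly_mapping_eqI simp: lk st lookup_add)
  have fin: "finite (\<sigma> -` J)" if "finite J" for J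
    using that inj(1) by (rule finite_vimageI)
  have "coeff (permute \<sigma> (f * g)) I e = (\<Sum>((J, a), (K, b))\<in>factorizations (\<sigma> -` I) (?m \<sigma> e).
      perm_sign \<sigma> (\<sigma> -` I) * shuffle_sign J K * coeff f J a * coeff g K b)"
    using I by (simp add: permute.rep_eq times_superseries.rep_eq sum_distrib_left split_def mult_ac)
  also have "\<dots> = (\<Sum>((J, a), (K, b))\<in>factorizations I e.
      shuffle_sign J K * coeff (permute \<sigma> f) J a * coeff (permute \<sigma> g) K b)"
  proof (rule sum.reindex_bij_witness[where
        i = "\<lambda>((J, a), (K, b)). ((\<sigma> -` J, ?m \<sigma> a), (\<sigma> -` K, ?m \<sigma> b))" and
        j = "\<lambda>((J, a), (K, b)). ((\<sigma> ` J, ?m \<tau> a), (\<sigma> ` K, ?m \<tau> b))"], goal_cases)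
    case (2 z)
    then obtain J a K b where z: "z = ((J, a), (K, b))" and d: "J \<inter> K = {}" "J \<union> K = \<sigma> -` I"
      and e: "a + b = ?m \<sigma> e"
      by (auto simp: factorizations_def)
    have "\<sigma> ` J \<union> \<sigma> ` K = I" using d(2) v(2)[of I] by (simp flip: image_Un)
    moreover have "\<sigma> ` J \<inter> \<sigma> ` K = {}" using d(1) inj(1) by (auto dest: injD)
    moreover have "?m \<tau> a + ?m \<tau> b = e" using e by (simp add: m(2) flip: m(4))
    ultimately show ?case by (simp add: z factorizations_def)
  next
    case (5 z)
    then obtain J a K b where z: "z = ((J, a), (K, b))" and d: "J \<inter> K = {}" "J \<union> K = \<sigma> -` I"
      by (auto simp: factorizations_def)
    have JK: "finite J" "finite K" using fin[OF I] d(2) by (metis finite_Un)+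
    then show ?case
      using perm_sign_Un[OF \<sigma> JK d(1)] by (simp add: z permute.rep_eq v m flip: d(2))
  qed (auto simp: factorizations_def v m inj_eq inj(1) bij_is_surj[OF \<sigma>])
  also have "\<dots> = coeff (permute \<sigma> f * permute \<sigma> g) I e"
    by (simp add: times_superseries.rep_eq)
  finally show "coeff (permute \<sigma> (f * g)) I e = coeff (permute \<sigma> f * permute \<sigma> g) I e" .
qed

lemma permute_theta: assumes "bij \<sigma>" shows "permute \<sigma> (theta i) = theta (\<sigma> i)"
proof (rule superseries_eqI)
  fix I :: "nat set" and e :: "nat \<Rightarrow>\<^sub>0 nat" assume "finite I"
  have inj: "inj \<sigma>" and surj: "surj \<sigma>" using assms by (simp_all add: bij_def)
  have "\<sigma> -` I = {i} \<longleftrightarrow> I = {\<sigma> i}"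
    by (metis image_empty image_insert inj inj_vimage_image_eq surj surj_image_vimage_eq)
  moreover have "Poly_Mapping.map_key \<sigma> e = 0 \<longleftrightarrow> e = 0"
    using surj by (auto simp: poly_mapping_eq_iff map_key.rep_eq[OF inj] fun_eq_iff) (metis surjD)
  ultimately show "coeff (permute \<sigma> (theta i)) I e = coeff (theta (\<sigma> i)) I e"
    using \<open>finite I\<close> by (auto simp: permute.rep_eq theta_def smonom.rep_eq perm_sign_def)
qed

lemma permute_xvar: assumes "bij \<sigma>" shows "permute \<sigma> (xvar i) = xvar (\<sigma> i)"
proof (rule superseries_eqI)
  fix I :: "nat set" and e :: "nat \<Rightarrow>\<^sub>0 nat" assume "finite I"
  have inj: "inj \<sigma>" and surj: "surj \<sigma>" using assms by (simp_all add: bij_def)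
  have "\<sigma> -` I = {} \<longleftrightarrow> I = {}"
    by (metis image_empty surj surj_image_vimage_eq vimage_empty)
  moreover have "Poly_Mapping.map_key \<sigma> e = Poly_Mapping.single i 1 \<longleftrightarrow>
      e = Poly_Mapping.single (\<sigma> i) 1"
  proof
    assume *: "Poly_Mapping.map_key \<sigma> e = Poly_Mapping.single i 1"
    show "e = Poly_Mapping.single (\<sigma> i) 1"
    proof (rule poly_mapping_eqI)
      fix k
      obtain j where "k = \<sigma> j" using surj by (metis surjD)
      moreover have "Poly_Mapping.lookup e (\<sigma> j) = Poly_Mapping.lookup (Poly_Mapping.single i 1) j"
        using * by (metis comp_apply inj map_key.rep_eq)
      ultimately show "Poly_Mapping.lookup e k = Poly_Mapping.lookup (Poly_Mapping.single (\<sigma> i) 1) k"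
        using inj by (auto simp: lookup_single inj_eq)
    qed
  qed (simp add: inj)
  ultimately show "coeff (permute \<sigma> (xvar i)) I e = coeff (xvar (\<sigma> i)) I e"
    using \<open>finite I\<close> by (auto simp: permute.rep_eq xvar_def smonom.rep_eq perm_sign_def)
qed

definition bounded_degree :: "superseries \<Rightarrow> bool" where
  "bounded_degree f \<longleftrightarrow>
    (\<exists>d. \<forall>I e. coeff f I e \<noteq> 0 \<longrightarrow> card I + (\<Sum>i\<in>Poly_Mapping.keys e. Poly_Mapping.lookup e i) \<le> d)"

definition sSym :: "superseries set" where
  "sSym = {f. bounded_degree f \<and> (\<forall>\<sigma>. bij \<sigma> \<longrightarrow> permute \<sigma> f = f)}"

text \<open>
  A superpartition is given by the pair of lists \<open>[\<Lambda>\<^sub>1, \<dots>, \<Lambda>\<^sub>m]\<close> and \<open>[\<Lambda>\<^bsub>m+1\<^esub>, \<dots>, \<Lambda>\<^sub>n]\<close>.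
\<close>

type_synonym spart = "nat list \<times> nat list"

definition superpartition :: "spart \<Rightarrow> bool" where
  "superpartition \<Lambda> \<longleftrightarrow> sorted_wrt (>) (fst \<Lambda>) \<and> sorted_wrt (\<ge>) (snd \<Lambda>) \<and> (\<forall>b\<in>set (snd \<Lambda>). 1 \<le> b)"

definition sparts :: "spart \<Rightarrow> nat list" where
  "sparts \<Lambda> = fst \<Lambda> @ snd \<Lambda>"

definition df :: "spart \<Rightarrow> nat" where
  "df \<Lambda> = length (fst \<Lambda>)"

definition spsize :: "spart \<Rightarrow> nat" where
  "spsize \<Lambda> = sum_list (sparts \<Lambda>)"

definition dcomp_of :: "spart \<Rightarrow> dcomp" where
  "dcomp_of \<Lambda> = DComp (map dotted (fst \<Lambda>) @ map undotted (snd \<Lambda>))"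

lemma finite_superpartitions: "finite {\<Lambda>. superpartition \<Lambda> \<and> spsize \<Lambda> = r \<and> df \<Lambda> = m}"
proof -
  have len: "length bs \<le> k + sum_list bs" if "\<forall>b\<in>set bs. Suc 0 \<le> b" for bs k
    using that by (induction bs) auto
  have "{\<Lambda>. superpartition \<Lambda> \<and> spsize \<Lambda> = r \<and> df \<Lambda> = m} \<subseteq>
      {as. set as \<subseteq> {..r} \<and> length as = m} \<times> {bs. set bs \<subseteq> {..r} \<and> length bs \<le> r}"
    by (auto simp: superpartition_def spsize_def sparts_def df_def
        intro: len dest: member_le_sum_list trans_le_add1 trans_le_add2)
  then show ?thesis
    by (rule finite_subset) (intro finite_cartesian_product finite_lists_length_eq finite_lists_length_le; simp)
qed

definition sterm :: "spart \<Rightarrow> nat list \<Rightarrow> superseries" where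
  "sterm \<Lambda> is = prod_list (map theta (take (df \<Lambda>) is)) *
    prod_list (map2 (\<lambda>i k. xvar i ^ k) is (sparts \<Lambda>))"

definition sterms :: "spart \<Rightarrow> superseries set" where
  "sterms \<Lambda> = {sterm \<Lambda> is | is. distinct is \<and> length is = length (sparts \<Lambda>)}"

text \<open>
  The sum of the (in general infinitely many) elements of \<open>sterms \<Lambda>\<close>, formed coefficientwise; by
  \<open>finite_sterms_coeff\<close> each coefficient receives only finitely many contributions.
\<close>

lift_definition m_fun :: "spart \<Rightarrow> superseries" is
  "\<lambda>\<Lambda> I e. \<Sum>t\<in>{t \<in> sterms \<Lambda>. coeff t I e \<noteq> 0}. coeff t I e" by simp

lemma shuffle_sign_cases: "shuffle_sign J K = 1 \<or> shuffle_sign J K = - 1"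
proof -
  have *: "(\<Prod>i\<in>A. f i) = 1 \<or> (\<Prod>i\<in>A. f i) = - 1"
    if "\<And>i. f i = 1 \<or> f i = - 1" for A :: "nat set" and f :: "nat \<Rightarrow> rat"
  proof (induction A rule: infinite_finite_induct)
    case (insert x F)
    with that[of x] show ?case by auto
  qed auto
  show ?thesis unfolding shuffle_sign_def by (intro *) auto
qed

lemma sterm_smonom:
  assumes "distinct is"
  obtains s I e where "sterm \<Lambda> is = scale s (smonom I e)" "s = 1 \<or> s = - 1"
proof -
  have theta_mult: "theta j * smonom J 0 = scale (shuffle_sign {j} J) (smonom (insert j J) 0)"
    if "finite J" "j \<notin> J" for j J
    using that by (simp add: theta_def smonom_mult)
  have T: "\<exists>s. (s = 1 \<or> s = - 1) \<and> prod_list (map theta js) = scale s (smonom (set js) 0)"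
    if "distinct js" for js
    using that
  proof (induction js)
    case Nil
    show ?case by (intro exI[of _ 1]) (simp add: smonom_one)
  next
    case (Cons j js)
    then obtain s where "s = 1 \<or> s = - 1" "prod_list (map theta js) = scale s (smonom (set js) 0)"
      by auto
    with Cons.prems shuffle_sign_cases[of "{j}" "set js"] show ?case
      by (intro exI[of _ "s * shuffle_sign {j} (set js)"])
        (auto simp: theta_mult scale_mult_right)
  qed
  have pow: "\<exists>e. xvar i ^ k = smonom {} e" for i k
  proof (induction k)
    case (Suc k)
    then show ?case by (auto simp: xvar_def smonom_mult)
  qed (auto simp flip: smonom_one)
  have X: "\<exists>e. prod_list (map2 (\<lambda>i k. xvar i ^ k) js ks) = smonom {} e" for js ks
  proof (induction js ks rule: list_induct2')
    case (4 j js k ks)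
    then obtain e where e: "prod_list (map2 (\<lambda>i k. xvar i ^ k) js ks) = smonom {} e" by blast
    obtain e' where "xvar j ^ k = smonom {} e'" using pow by blast
    with e show ?case by (auto simp: smonom_mult)
  qed (auto simp flip: smonom_one)
  from T[of "take (df \<Lambda>) is"] X[of "is" "sparts \<Lambda>"] assms obtain s e where
    "s = 1 \<or> s = - 1" "prod_list (map theta (take (df \<Lambda>) is)) = scale s (smonom (set (take (df \<Lambda>) is)) 0)"
    "prod_list (map2 (\<lambda>i k. xvar i ^ k) is (sparts \<Lambda>)) = smonom {} e"
    by auto
  then show ?thesis
    by (intro that[of s "set (take (df \<Lambda>) is)" e])
      (simp_all add: sterm_def scale_mult_left smonom_mult)
qed

lemma finite_sterms_coeff: "finite {t \<in> sterms \<Lambda>. coeff t I e \<noteq> 0}"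
proof -
  have "{t \<in> sterms \<Lambda>. coeff t I e \<noteq> 0} \<subseteq> {scale 1 (smonom I e), scale (- 1) (smonom I e)}"
  proof
    fix t assume "t \<in> {t \<in> sterms \<Lambda>. coeff t I e \<noteq> 0}"
    then obtain "is" where "is": "distinct is" "t = sterm \<Lambda> is" and nz: "coeff t I e \<noteq> 0"
      by (auto simp: sterms_def)
    from sterm_smonom[OF "is"(1)] obtain s J a
      where "t = scale s (smonom J a)" "s = 1 \<or> s = - 1" using "is"(2) by metis
    with nz show "t \<in> {scale 1 (smonom I e), scale (- 1) (smonom I e)}"
      by (auto simp: scale.rep_eq smonom.rep_eq split: if_splits)
  qed
  then show ?thesis by (rule finite_subset) simp
qed

definition h_fun :: "nat \<Rightarrow> superseries" where
  "h_fun r = (\<Sum>\<Lambda>\<in>{\<Lambda>. superpartition \<Lambda> \<and> spsize \<Lambda> = r \<and> df \<Lambda> = 0}. m_fun \<Lambda>)"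

definition htilde_fun :: "nat \<Rightarrow> superseries" where
  "htilde_fun k = (\<Sum>\<Lambda>\<in>{\<Lambda>. superpartition \<Lambda> \<and> spsize \<Lambda> = k \<and> df \<Lambda> = 1}.
    scale (of_nat (hd (sparts \<Lambda>) + 1)) (m_fun \<Lambda>))"

definition gen_h :: "dpart \<Rightarrow> superseries" where
  "gen_h p = (if is_dotted p then htilde_fun (pval p) else h_fun (pval p))"

text \<open>
  The linear extension of \<open>H\<^sub>\<alpha> \<mapsto> h\<^bsub>\<alpha>\<^sub>1\<^esub> \<cdots> h\<^bsub>\<alpha>\<^sub>k\<^esub>\<close>; by \<open>proj_add\<close>, \<open>proj_mult\<close>,
  \<open>proj_one\<close>, \<open>proj_scalar\<close>, \<open>proj_gen_H\<close> and \<open>proj_unique\<close> it is the unique algebra morphism with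
  the prescribed values on the generators.
\<close>

definition proj :: "snsym \<Rightarrow> superseries" where
  "proj f = (\<Sum>\<alpha>\<in>Poly_Mapping.keys f. scale (Poly_Mapping.lookup f \<alpha>) (prod_list (map gen_h (entries \<alpha>))))"

lemma proj_superset:
  assumes "finite A" "Poly_Mapping.keys f \<subseteq> A"
  shows "proj f = (\<Sum>\<alpha>\<in>A. scale (Poly_Mapping.lookup f \<alpha>) (prod_list (map gen_h (entries \<alpha>))))"
  unfolding proj_def using assms by (intro sum.mono_neutral_left) (auto simp: in_keys_iff)

lemma proj_single: "proj (Poly_Mapping.single \<alpha> c) = scale c (prod_list (map gen_h (entries \<alpha>)))"
  by (subst proj_superset[of "{\<alpha>}"]) auto

lemma proj_add: "proj (f + g) = proj f + proj g"
proof -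
  have "Poly_Mapping.keys (f + g) \<subseteq> Poly_Mapping.keys f \<union> Poly_Mapping.keys g" by (rule keys_add)
  then show ?thesis
    by (simp add: proj_superset[of "Poly_Mapping.keys f \<union> Poly_Mapping.keys g"] lookup_add superspace.scale_left_distrib
        sum.distrib)
qed

lemma proj_zero: "proj 0 = 0"
  by (simp add: proj_def)

lemma proj_sum: "proj (sum f A) = (\<Sum>a\<in>A. proj (f a))"
  by (induction A rule: infinite_finite_induct) (simp_all add: proj_zero proj_add)

lemma snsym_expansion: "f = (\<Sum>\<alpha>\<in>Poly_Mapping.keys f. Poly_Mapping.single \<alpha> (Poly_Mapping.lookup f \<alpha>))" for f :: snsym
  by (rule poly_mapping_eqI)
    (auto simp: lookup_sum lookup_single when_def in_keys_iff sum.delta)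

lemma proj_mult: "proj (f * g) = proj f * proj g"
proof -
  have "f * g = (\<Sum>\<alpha>\<in>Poly_Mapping.keys f. \<Sum>\<beta>\<in>Poly_Mapping.keys g.
      Poly_Mapping.single \<alpha> (Poly_Mapping.lookup f \<alpha>) * Poly_Mapping.single \<beta> (Poly_Mapping.lookup g \<beta>))"
    by (subst snsym_expansion[of f], subst snsym_expansion[of g], rule sum_product)
  also have "proj \<dots> = (\<Sum>\<alpha>\<in>Poly_Mapping.keys f. \<Sum>\<beta>\<in>Poly_Mapping.keys g.
      scale (Poly_Mapping.lookup f \<alpha>) (prod_list (map gen_h (entries \<alpha>))) *
      scale (Poly_Mapping.lookup g \<beta>) (prod_list (map gen_h (entries \<beta>))))"
    by (simp add: proj_sum mult_single proj_single plus_dcomp_def scale_mult_left scale_mult_right mult.commute)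
  also have "\<dots> = proj f * proj g"
    by (simp add: proj_def sum_product)
  finally show ?thesis .
qed

lemma proj_one: "proj 1 = 1"
  using proj_single[of 0 1] by (simp add: zero_dcomp_def flip: single_one)

lemma proj_scalar: "proj (Poly_Mapping.single 0 c * f) = scale c (proj f)"
  by (simp add: proj_mult proj_single zero_dcomp_def scale_mult_left)

lemma proj_gen_H:
  "1 \<le> n \<Longrightarrow> proj (gen_H (undotted n)) = h_fun n"
  "proj (gen_H (dotted k)) = htilde_fun k"
  by (simp_all add: gen_H_def proj_single gen_h_def)

lemma proj_unique:
  fixes \<phi> :: "snsym \<Rightarrow> superseries"
  assumes add: "\<And>f g. \<phi> (f + g) = \<phi> f + \<phi> g"
    and mult: "\<And>f g. \<phi> (f * g) = \<phi> f * \<phi> g"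
    and one: "\<phi> 1 = 1"
    and scalar: "\<And>c f. \<phi> (Poly_Mapping.single 0 c * f) = scale c (\<phi> f)"
    and undotted: "\<And>n. 1 \<le> n \<Longrightarrow> \<phi> (gen_H (undotted n)) = h_fun n"
    and dotted: "\<And>k. \<phi> (gen_H (dotted k)) = htilde_fun k"
  shows "\<phi> = proj"
proof
  fix f
  have gen: "\<phi> (gen_H p) = gen_h p" for p
    by (cases p rule: dpart_cases) (simp_all add: undotted dotted gen_h_def)
  have lst: "\<phi> (prod_list (map gen_H ps)) = prod_list (map gen_h ps)" for ps
    by (induction ps) (simp_all add: one mult gen)
  have single: "\<phi> (Poly_Mapping.single \<alpha> c) = proj (Poly_Mapping.single \<alpha> c)" for \<alpha> c
  proof -
    have "Poly_Mapping.single \<alpha> c = Poly_Mapping.single 0 c * H \<alpha>"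
      by (simp add: H_eq_single mult_single)
    then have "\<phi> (Poly_Mapping.single \<alpha> c) = scale c (\<phi> (H \<alpha>))"
      by (simp only: scalar)
    then show ?thesis
      by (simp only: proj_single H_def lst)
  qed
  have zero: "\<phi> 0 = 0" using add[of 0 0] by simp
  have sum: "\<phi> (sum F A) = (\<Sum>a\<in>A. \<phi> (F a))" for F and A :: "dcomp set"
    by (induction A rule: infinite_finite_induct) (simp_all add: zero add)
  show "\<phi> f = proj f"
    by (subst (1 2) snsym_expansion[of f]) (simp only: sum proj_sum single)
qed

definition ribbon_r :: "dcomp \<Rightarrow> superseries" where
  "ribbon_r \<alpha> = proj (ribbon_R \<alpha>)"

end

theory Submission
  imports Defs "HOL-Combinatorics.Permutations"
begin

text \<open>
  Filter \<open>sSym\<close> by total degree, where each \<open>\<theta>\<^sub>i\<close> and each \<open>x\<^sub>i\<close> has degree \<open>1\<close>.  The superpartitions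
  whose ribbon function has degree at most \<open>d\<close> form a finite set \<open>spart_upto d\<close>, and it suffices to
  show that their ribbon functions are a basis of \<open>sSym_upto d\<close>, for every \<open>d\<close>.

  A basis indexed by the same superpartitions is given by products of power sums \<open>\<Sum>\<^sub>i x\<^sub>i\<^sup>n\<close> and
  \<open>\<Sum>\<^sub>i \<theta>\<^sub>i x\<^sub>i\<^sup>n\<close>.  Indeed, a product of \<open>l\<close> power sums involves only monomials in at most \<open>l\<close>
  variables.  Those in exactly \<open>l\<close> variables arise by taking each factor at a variable of its own, so
  they all have the shape of the given superpartition, and their coefficients do not vanish
  (\<open>coeff_power_prod_other_shape\<close>, \<open>coeff_power_prod_same_shape\<close>).  On the other hand, a symmetric
  series is determined by one coefficient for each superpartition: two monomials of the same shape
  are related by a permutation of the variables (\<open>coeff_eq_zero_iff_shape_eq\<close>), and exchanging two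
  variables with equal dotted entries changes the sign of a monomial (\<open>coeff_repeated_dots\<close>).  This
  triangularity gives linear independence (\<open>independent_superpower\<close>) and, by eliminating the
  monomials with the most variables first, spanning (\<open>in_span_superpower\<close>).

  The Newton identities \<open>n h\<^sub>n = \<Sum>\<^sub>k p\<^sub>k h\<^bsub>n-k\<^esub>\<close> and \<open>h'\<^sub>n = \<Sum>\<^sub>k p'\<^sub>k h\<^bsub>n-k\<^esub>\<close>, where primes mark the dotted
  versions, express the power sums by the complete functions without raising the degree
  (\<open>newton_undotted\<close>, \<open>newton_dotted\<close>).  So the products of complete functions span \<open>sSym_upto d\<close>.
  Since complete functions commute or anticommute, only the products indexed by superpartitions are
  needed, and each of these is the corresponding ribbon function plus products with fewer factors
  (\<open>h_prod_in_span_superribbon\<close>).  Hence the ribbon functions span \<open>sSym_upto d\<close> as well, and as they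
  are no more numerous than the basis of power sums, they are independent
  (\<open>superribbon_upto_basis\<close>).
\<close>


section \<open>Shapes of monomials\<close>

definition exp_degree :: "(nat \<Rightarrow>\<^sub>0 nat) \<Rightarrow> nat" where
  "exp_degree e = (\<Sum>i\<in>Poly_Mapping.keys e. Poly_Mapping.lookup e i)"

definition vars :: "nat set \<Rightarrow> (nat \<Rightarrow>\<^sub>0 nat) \<Rightarrow> nat set" where
  "vars I e = I \<union> Poly_Mapping.keys e"

text \<open>Only meaningful for variables \<open>i \<in> vars I e\<close>, so that an undotted entry is positive.\<close>

definition var_entry :: "nat set \<Rightarrow> (nat \<Rightarrow>\<^sub>0 nat) \<Rightarrow> nat \<Rightarrow> dpart" where
  "var_entry I e i = (if i \<in> I then dotted (Poly_Mapping.lookup e i) else undotted (Poly_Mapping.lookup e i))"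

text \<open>
  The shape of the monomial \<open>\<theta>\<^sub>I x\<^sup>e\<close> determines its orbit under permutations of the variables,
  up to sign.
\<close>

definition shape :: "nat set \<Rightarrow> (nat \<Rightarrow>\<^sub>0 nat) \<Rightarrow> dpart multiset" where
  "shape I e = image_mset (var_entry I e) (mset_set (vars I e))"

text \<open>The total degree, with each \<open>\<theta>\<^sub>i\<close> of degree \<open>1\<close>, carried by an entry.\<close>

definition entry_degree :: "dpart \<Rightarrow> nat" where
  "entry_degree p = pval p + of_bool (is_dotted p)"

text \<open>
  By \<open>dots_distinct_entry_mset\<close>, \<open>superpartition_with_entries\<close> and \<open>entry_mset_inj\<close>, the multisets
  with this property correspond to the superpartitions.
\<close>

definition dots_distinct :: "dpart multiset \<Rightarrow> bool" where
  "dots_distinct M \<longleftrightarrow> (\<forall>p. is_dotted p \<longrightarrow> count M p \<le> 1)"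

lemma exp_degree_superset:
  "finite A \<Longrightarrow> Poly_Mapping.keys e \<subseteq> A \<Longrightarrow> exp_degree e = (\<Sum>i\<in>A. Poly_Mapping.lookup e i)"
  unfolding exp_degree_def by (intro sum.mono_neutral_left) (auto simp: in_keys_iff)

lemma exp_degree_add: "exp_degree (a + b) = exp_degree a + exp_degree b"
proof -
  have "Poly_Mapping.keys (a + b) \<subseteq> Poly_Mapping.keys a \<union> Poly_Mapping.keys b" by (rule keys_add)
  then show ?thesis
    by (simp add: exp_degree_superset[of "Poly_Mapping.keys a \<union> Poly_Mapping.keys b"] lookup_add sum.distrib)
qed

lemma exp_degree_single [simp]: "exp_degree (Poly_Mapping.single i k) = k"
  by (simp add: exp_degree_superset[of "{i}"])

lemma exp_degree_zero [simp]: "exp_degree 0 = 0"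
  by (simp add: exp_degree_def)

lemma finite_vars [simp]: "finite (vars I e) \<longleftrightarrow> finite I"
  by (simp add: vars_def)

lemma var_entry_vars:
  assumes "i \<in> vars I e"
  shows is_dotted_var_entry: "is_dotted (var_entry I e i) \<longleftrightarrow> i \<in> I"
    and pval_var_entry: "pval (var_entry I e i) = Poly_Mapping.lookup e i"
proof -
  have "Poly_Mapping.lookup e i \<ge> 1" if "i \<notin> I"
    using assms that by (simp add: vars_def in_keys_iff Suc_le_eq)
  then show "is_dotted (var_entry I e i) \<longleftrightarrow> i \<in> I" "pval (var_entry I e i) = Poly_Mapping.lookup e i"
    by (auto simp: var_entry_def)
qed

lemma undotted_pval: "\<not> is_dotted p \<Longrightarrow> undotted (pval p) = p"
  by (cases p rule: dpart_cases) auto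

lemma dotted_pval: "is_dotted p \<Longrightarrow> dotted (pval p) = p"
  by (cases p rule: dpart_cases) auto

lemma pval_pos: "\<not> is_dotted p \<Longrightarrow> 1 \<le> pval p"
  by (cases p rule: dpart_cases) auto

lemma size_shape: "size (shape I e) = card (vars I e)"
  by (simp add: shape_def)

lemma degree_shape:
  assumes "finite I"
  shows "sum_mset (image_mset entry_degree (shape I e)) = card I + exp_degree e"
proof -
  have "sum_mset (image_mset entry_degree (shape I e)) = (\<Sum>i\<in>vars I e. entry_degree (var_entry I e i))"
    by (simp add: shape_def sum_unfold_sum_mset multiset.map_comp comp_def)
  also have "\<dots> = (\<Sum>i\<in>vars I e. Poly_Mapping.lookup e i + of_bool (i \<in> I))"
    by (intro sum.cong refl) (simp add: entry_degree_def is_dotted_var_entry pval_var_entry)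
  also have "\<dots> = exp_degree e + card (vars I e \<inter> I)"
    using assms by (subst exp_degree_superset[of "vars I e"]) (auto simp: sum.distrib vars_def of_bool_def sum.If_cases)
  also have "vars I e \<inter> I = I" by (auto simp: vars_def)
  finally show ?thesis by simp
qed

lemma count_image_mset_set:
  "finite A \<Longrightarrow> count (image_mset f (mset_set A)) y = card {x \<in> A. f x = y}"
proof (induction A rule: finite_induct)
  case (insert x A)
  have "{z \<in> insert x A. f z = y} = (if f x = y then insert x {z \<in> A. f z = y} else {z \<in> A. f z = y})"
    by auto
  with insert show ?case by simp
qed simp

text \<open>
  Equal shapes match the occurring variables of the two monomials bijectively.  Beyond these
  variables, all variables look alike, so the bijection can be extended to a permutation that moves
  only finitely many variables.
\<close>

lemma shape_eq_permutation:
  assumes "finite I" "finite J" "shape I e = shape J a"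
  obtains \<sigma> where "bij \<sigma>" "I = \<sigma> -` J" "e = Poly_Mapping.map_key \<sigma> a"
proof -
  define A where "A = vars I e \<union> vars J a"
  define f where "f K b i = (i \<in> K, Poly_Mapping.lookup b i)" for K and b :: "nat \<Rightarrow>\<^sub>0 nat" and i
  have A: "finite A" using assms by (simp add: A_def)
  have split: "image_mset (f K b) (mset_set A) =
      image_mset (\<lambda>p. (is_dotted p, pval p)) (shape K b) +
      replicate_mset (card A - size (shape K b)) (False, 0)"
    if "finite K" "vars K b \<subseteq> A" for K b
  proof -
    have "mset_set A = mset_set (vars K b) + mset_set (A - vars K b)"
      using that A by (subst mset_set_Union[symmetric]) (auto simp: Un_absorb1)
    moreover have "image_mset (f K b) (mset_set (vars K b)) =
        image_mset (\<lambda>p. (is_dotted p, pval p)) (shape K b)"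
      unfolding shape_def multiset.map_comp
      by (rule image_mset_cong) (simp add: that f_def is_dotted_var_entry pval_var_entry)
    moreover have "image_mset (f K b) (mset_set (A - vars K b)) =
        image_mset (\<lambda>_. (False, 0)) (mset_set (A - vars K b))"
      by (rule image_mset_cong) (use A in \<open>auto simp: f_def vars_def in_keys_iff\<close>)
    moreover have "card (A - vars K b) = card A - size (shape K b)"
      using that A by (simp add: size_shape card_Diff_subset finite_subset)
    ultimately show ?thesis by (simp add: image_mset_const_eq)
  qed
  have "vars I e \<subseteq> A" "vars J a \<subseteq> A" by (auto simp: A_def)
  then have "image_mset (f I e) (mset_set A) = image_mset (f J a) (mset_set A)"
    using assms by (simp add: split)
  with A obtain \<sigma> where \<sigma>: "\<sigma> permutes A" and eq: "\<forall>x\<in>A. f I e x = f J a (\<sigma> x)"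
    by (rule image_mset_eq_implies_permutes)
  have eq': "f I e x = f J a (\<sigma> x)" for x
  proof (cases "x \<in> A")
    case False
    then have "\<sigma> x = x" using \<sigma> by (simp add: permutes_not_in)
    with False show ?thesis by (auto simp: f_def A_def vars_def in_keys_iff)
  qed (use eq in simp)
  have "bij \<sigma>" using \<sigma> by (rule permutes_bij)
  moreover have "I = \<sigma> -` J" using eq' by (auto simp: f_def)
  moreover have "e = Poly_Mapping.map_key \<sigma> a"
    by (rule poly_mapping_eqI) (use eq' in \<open>simp add: f_def map_key.rep_eq[OF bij_is_inj[OF \<open>bij \<sigma>\<close>]]\<close>)
  ultimately show ?thesis by (rule that)
qed


section \<open>Superpartitions as multisets of entries\<close>

definition entry_mset :: "spart \<Rightarrow> dpart multiset" where
  "entry_mset \<Lambda> = mset (entries (dcomp_of \<Lambda>))"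

lemma entry_mset_eq: "entry_mset \<Lambda> = image_mset dotted (mset (fst \<Lambda>)) + image_mset undotted (mset (snd \<Lambda>))"
  by (simp add: entry_mset_def dcomp_of_def)

lemma dotted_eq_iff [simp]: "dotted m = dotted n \<longleftrightarrow> m = n"
  by (metis pval_dotted)

lemma count_image_mset_dotted: "count (image_mset dotted A) (dotted n) = count A n"
  by (induction A) auto

lemma dots_distinct_entry_mset:
  assumes "superpartition \<Lambda>" shows "dots_distinct (entry_mset \<Lambda>)"
proof -
  have "distinct (fst \<Lambda>)"
    using assms unfolding superpartition_def by (auto simp: sorted_wrt_iff_nth_less distinct_conv_nth) (metis nat_neq_iff)
  then have d: "count (mset (fst \<Lambda>)) a \<le> 1" for a by (simp add: distinct_count_atmost_1)
  show ?thesis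
    unfolding dots_distinct_def
  proof (intro allI impI)
    fix p assume p: "is_dotted p"
    have "count (image_mset undotted (mset (snd \<Lambda>))) p = 0"
      using p assms by (intro not_in_iff[THEN iffD1]) (auto simp: superpartition_def)
    moreover have "count (image_mset dotted (mset (fst \<Lambda>))) (dotted n) = count (mset (fst \<Lambda>)) n" for n
      by (rule count_image_mset_dotted)
    ultimately show "count (entry_mset \<Lambda>) p \<le> 1"
      using d dotted_pval[OF p] by (metis entry_mset_eq count_union add_0_right)
  qed
qed

lemma superpartition_with_entries:
  assumes "dots_distinct M" obtains \<Lambda> where "superpartition \<Lambda>" "entry_mset \<Lambda> = M"
proof -
  define A where "A = image_mset pval (filter_mset is_dotted M)"
  define B where "B = image_mset pval (filter_mset (\<lambda>p. \<not> is_dotted p) M)"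
  define \<Lambda> where "\<Lambda> = (rev (sorted_list_of_multiset A), rev (sorted_list_of_multiset B))"
  have "image_mset (\<lambda>p. dotted (pval p)) (filter_mset is_dotted M) = image_mset (\<lambda>p. p) (filter_mset is_dotted M)"
    by (rule image_mset_cong) (auto simp: dotted_pval)
  then have mA: "image_mset dotted A = filter_mset is_dotted M"
    by (simp add: A_def multiset.map_comp comp_def)
  have "image_mset (\<lambda>p. undotted (pval p)) (filter_mset (\<lambda>p. \<not> is_dotted p) M) =
      image_mset (\<lambda>p. p) (filter_mset (\<lambda>p. \<not> is_dotted p) M)"
    by (rule image_mset_cong) (auto simp: undotted_pval)
  then have mB: "image_mset undotted B = filter_mset (\<lambda>p. \<not> is_dotted p) M"
    by (simp add: B_def multiset.map_comp comp_def)
  have "entry_mset \<Lambda> = M"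
    by (simp add: entry_mset_eq \<Lambda>_def mA mB)
  moreover have "superpartition \<Lambda>"
  proof -
    have "count A n \<le> 1" for n
    proof -
      have "count A n = count (image_mset dotted A) (dotted n)"
        by (rule count_image_mset_dotted[symmetric])
      also have "\<dots> \<le> 1" using assms by (simp add: mA dots_distinct_def)
      finally show ?thesis .
    qed
    then have "distinct (sorted_list_of_multiset A)"
      by (auto simp: distinct_count_atmost_1 intro!: le_antisym simp: Suc_le_eq not_in_iff)
    then have "sorted_wrt (<) (sorted_list_of_multiset A)"
      by (simp add: strict_sorted_iff)
    then have "sorted_wrt (>) (fst \<Lambda>)"
      by (simp add: \<Lambda>_def sorted_wrt_rev)
    moreover have "sorted_wrt (\<ge>) (snd \<Lambda>)"
      by (simp add: \<Lambda>_def sorted_wrt_rev)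
    moreover have "\<forall>b\<in>set (snd \<Lambda>). 1 \<le> b"
      using pval_pos by (auto simp: \<Lambda>_def B_def)
    ultimately show ?thesis by (simp add: superpartition_def)
  qed
  ultimately show ?thesis using that by blast
qed

lemma entry_mset_inj:
  assumes "superpartition \<Lambda>" "superpartition M" "entry_mset \<Lambda> = entry_mset M"
  shows "\<Lambda> = M"
proof -
  have A: "mset (fst \<Lambda>) = image_mset pval (filter_mset is_dotted (entry_mset \<Lambda>))"
    and B: "mset (snd \<Lambda>) = image_mset pval (filter_mset (\<lambda>p. \<not> is_dotted p) (entry_mset \<Lambda>))"
    if "superpartition \<Lambda>" for \<Lambda>
  proof -
    have pos: "1 \<le> b" if "b \<in># mset (snd \<Lambda>)" for b
      using \<open>superpartition \<Lambda>\<close> that by (simp add: superpartition_def)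
    have "filter_mset is_dotted (image_mset undotted (mset (snd \<Lambda>))) = {#}"
      using pos by (auto simp: filter_mset_eq_mempty_iff)
    moreover have "filter_mset is_dotted (image_mset dotted (mset (fst \<Lambda>))) = image_mset dotted (mset (fst \<Lambda>))"
      by (auto simp: filter_mset_eq_conv)
    ultimately show "mset (fst \<Lambda>) = image_mset pval (filter_mset is_dotted (entry_mset \<Lambda>))"
      by (simp add: entry_mset_eq multiset.map_comp comp_def)
    have "filter_mset (\<lambda>p. \<not> is_dotted p) (image_mset dotted (mset (fst \<Lambda>))) = {#}"
      by (auto simp: filter_mset_eq_mempty_iff)
    moreover have "filter_mset (\<lambda>p. \<not> is_dotted p) (image_mset undotted (mset (snd \<Lambda>))) = image_mset undotted (mset (snd \<Lambda>))"
      using pos by (auto simp: filter_mset_eq_conv)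
    moreover have "image_mset (\<lambda>b. pval (undotted b)) (mset (snd \<Lambda>)) = image_mset (\<lambda>b. b) (mset (snd \<Lambda>))"
      using pos by (intro image_mset_cong) auto
    ultimately show "mset (snd \<Lambda>) = image_mset pval (filter_mset (\<lambda>p. \<not> is_dotted p) (entry_mset \<Lambda>))"
      by (simp add: entry_mset_eq multiset.map_comp comp_def)
  qed
  have eq: "xs = ys" if "sorted_wrt (\<ge>) xs" "sorted_wrt (\<ge>) ys" "mset xs = mset ys" for xs ys :: "nat list"
  proof -
    have "sorted (rev xs)" "sorted (rev ys)" "mset (rev xs) = mset (rev ys)"
      using that by (simp_all add: sorted_wrt_rev)
    then have "rev xs = rev ys" by (metis sort_key_id_if_sorted properties_for_sort map_ident)
    then show ?thesis by simp
  qed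
  have "sorted_wrt (\<ge>) xs" if "sorted_wrt (>) xs" for xs :: "nat list"
    using that by (rule sorted_wrt_mono_rel[rotated]) auto
  with assms A B eq show ?thesis
    unfolding superpartition_def by (intro prod_eqI) metis+
qed


section \<open>Symmetric series of bounded degree\<close>

text \<open>
  Unlike \<open>sSym\<close>, these subspaces have finite dimension, so that spanning families can be
  recognised as bases by counting.
\<close>

definition sSym_upto :: "nat \<Rightarrow> superseries set" where
  "sSym_upto d = {f. (\<forall>I e. coeff f I e \<noteq> 0 \<longrightarrow> card I + exp_degree e \<le> d) \<and>
    (\<forall>\<sigma>. bij \<sigma> \<longrightarrow> permute \<sigma> f = f)}"

lemma sSym_eq_Union: "sSym = (\<Union>d. sSym_upto d)"
  by (auto simp: sSym_def sSym_upto_def bounded_degree_def exp_degree_def)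

lemma sSym_uptoI:
  assumes "\<And>I e. coeff f I e \<noteq> 0 \<Longrightarrow> card I + exp_degree e \<le> d"
    and "\<And>\<sigma>. bij \<sigma> \<Longrightarrow> permute \<sigma> f = f"
  shows "f \<in> sSym_upto d"
  using assms by (auto simp: sSym_upto_def)

lemma sSym_upto_degree: "f \<in> sSym_upto d \<Longrightarrow> coeff f I e \<noteq> 0 \<Longrightarrow> card I + exp_degree e \<le> d"
  by (auto simp: sSym_upto_def)

lemma sSym_upto_permute: "f \<in> sSym_upto d \<Longrightarrow> bij \<sigma> \<Longrightarrow> permute \<sigma> f = f"
  by (auto simp: sSym_upto_def)

lemma sSym_upto_mono: "d \<le> d' \<Longrightarrow> sSym_upto d \<subseteq> sSym_upto d'"
  by (auto simp: sSym_upto_def intro: order_trans)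

lemma permute_add: "permute \<sigma> (f + g) = permute \<sigma> f + permute \<sigma> g"
  by (rule superseries_eqI) (simp add: permute.rep_eq plus_superseries.rep_eq algebra_simps)

lemma permute_scale: "permute \<sigma> (scale c f) = scale c (permute \<sigma> f)"
  by (rule superseries_eqI) (simp add: permute.rep_eq scale.rep_eq)

lemma subspace_sSym_upto: "superspace.subspace (sSym_upto d)"
proof (rule superspace.subspaceI)
  show "0 \<in> sSym_upto d"
    by (rule sSym_uptoI) (auto simp: zero_superseries.rep_eq permute.rep_eq intro!: superseries_eqI)
next
  fix f g assume fg: "f \<in> sSym_upto d" "g \<in> sSym_upto d"
  show "f + g \<in> sSym_upto d"
  proof (rule sSym_uptoI)
    fix I e assume "coeff (f + g) I e \<noteq> 0"
    then have "coeff f I e \<noteq> 0 \<or> coeff g I e \<noteq> 0" by (auto simp: plus_superseries.rep_eq)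
    then show "card I + exp_degree e \<le> d" using fg sSym_upto_degree by blast
  qed (use fg in \<open>simp add: permute_add sSym_upto_permute\<close>)
next
  fix c f assume f: "f \<in> sSym_upto d"
  show "scale c f \<in> sSym_upto d"
  proof (rule sSym_uptoI)
    fix I e assume "coeff (scale c f) I e \<noteq> 0"
    then show "card I + exp_degree e \<le> d" using f sSym_upto_degree by (auto simp: scale.rep_eq)
  qed (use f in \<open>simp add: permute_scale sSym_upto_permute\<close>)
qed

lemma coeff_mult_nonzeroE:
  assumes "coeff (f * g) I e \<noteq> 0"
  obtains J K a b where "J \<inter> K = {}" "I = J \<union> K" "e = a + b" "coeff f J a \<noteq> 0" "coeff g K b \<noteq> 0"
proof -
  have "\<exists>z\<in>factorizations I e. (case z of ((J, a), (K, b)) \<Rightarrow> shuffle_sign J K * coeff f J a * coeff g K b) \<noteq> 0"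
    using assms unfolding times_superseries.rep_eq by (rule contrapos_np) (rule sum.neutral, simp add: split_def)
  then show ?thesis using that by (auto simp: factorizations_def)
qed

lemma sSym_upto_mult:
  assumes f: "f \<in> sSym_upto d" and g: "g \<in> sSym_upto d'"
  shows "f * g \<in> sSym_upto (d + d')"
proof (rule sSym_uptoI)
  fix I e assume nz: "coeff (f * g) I e \<noteq> 0"
  then have "finite I" by (metis coeff_infinite)
  from nz obtain J K a b where *: "J \<inter> K = {}" "I = J \<union> K" "e = a + b" "coeff f J a \<noteq> 0" "coeff g K b \<noteq> 0"
    by (rule coeff_mult_nonzeroE)
  then have "card I = card J + card K" using \<open>finite I\<close> by (simp add: card_Un_disjoint)
  with * sSym_upto_degree[OF f, of J a] sSym_upto_degree[OF g, of K b]
  show "card I + exp_degree e \<le> d + d'" by (simp add: exp_degree_add)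
qed (simp add: permute_mult sSym_upto_permute[OF f] sSym_upto_permute[OF g])

lemma sSym_upto_one: "1 \<in> sSym_upto 0"
proof (rule sSym_uptoI)
  fix \<sigma> :: "nat \<Rightarrow> nat" assume \<sigma>: "bij \<sigma>"
  then have inj: "inj \<sigma>" by (rule bij_is_inj)
  have "Poly_Mapping.map_key \<sigma> e = 0 \<longleftrightarrow> e = 0" for e :: "nat \<Rightarrow>\<^sub>0 nat"
    using \<sigma> by (auto simp: poly_mapping_eq_iff map_key.rep_eq[OF inj] fun_eq_iff) (metis bij_pointE)
  moreover have "\<sigma> -` I = {} \<longleftrightarrow> I = {}" for I
    using \<sigma> by (metis bij_is_surj image_empty surj_image_vimage_eq vimage_empty)
  ultimately show "permute \<sigma> 1 = 1"
    by (intro superseries_eqI) (auto simp: permute.rep_eq one_superseries.rep_eq perm_sign_def)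
qed (auto simp: one_superseries.rep_eq split: if_splits)

lemma sSym_upto_prod_list:
  assumes "\<And>x. x \<in> set xs \<Longrightarrow> g x \<in> sSym_upto (deg x)"
  shows "prod_list (map g xs) \<in> sSym_upto (\<Sum>x\<leftarrow>xs. deg x)"
  using assms by (induction xs) (auto simp: sSym_upto_one intro: sSym_upto_mult)

lemma perm_sign_cases: "perm_sign \<sigma> J = 1 \<or> perm_sign \<sigma> J = - 1"
proof -
  have *: "(\<Prod>i\<in>A. f i) = 1 \<or> (\<Prod>i\<in>A. f i) = - 1"
    if "\<And>i. f i = 1 \<or> f i = - 1" for A :: "nat set" and f :: "nat \<Rightarrow> rat"
  proof (induction A rule: infinite_finite_induct)
    case (insert x F)
    with that[of x] show ?case by auto
  qed auto
  show ?thesis unfolding perm_sign_def by (intro *) auto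
qed

lemma coeff_permute_invariant:
  assumes "permute \<sigma> f = f" "finite J"
  shows "coeff f J a = perm_sign \<sigma> (\<sigma> -` J) * coeff f (\<sigma> -` J) (Poly_Mapping.map_key \<sigma> a)"
  using assms permute.rep_eq[of \<sigma> f] by metis

text \<open>
  Two monomials of equal shape are exchanged by a permutation of the variables, which fixes \<open>f\<close> and
  acts on coefficients with a sign.
\<close>

lemma coeff_eq_zero_iff_shape_eq:
  assumes "f \<in> sSym_upto d" "finite I" "finite J" "shape I e = shape J a"
  shows "coeff f I e = 0 \<longleftrightarrow> coeff f J a = 0"
proof -
  obtain \<sigma> where \<sigma>: "bij \<sigma>" "I = \<sigma> -` J" "e = Poly_Mapping.map_key \<sigma> a"
    using shape_eq_permutation assms by blast
  with assms show ?thesis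
    using coeff_permute_invariant[of \<sigma> f J a] perm_sign_cases[of \<sigma> "\<sigma> -` J"]
    by (auto simp: sSym_upto_permute)
qed

text \<open>
  If \<open>i\<close>, \<open>j\<close> are distinct elements of \<open>I\<close> with \<open>e\<^sub>i = e\<^sub>j\<close>, the transposition of \<open>i\<close> and \<open>j\<close> maps
  \<open>\<theta>\<^sub>I x\<^sup>e\<close> to its negative.
\<close>

lemma coeff_repeated_dots:
  assumes f: "f \<in> sSym_upto d" and I: "finite I" and rep: "\<not> dots_distinct (shape I e)"
  shows "coeff f I e = 0"
proof -
  obtain p where p: "is_dotted p" "\<not> count (shape I e) p \<le> 1"
    using rep by (auto simp: dots_distinct_def)
  define S where "S = {i \<in> vars I e. var_entry I e i = p}"
  have "\<not> card S \<le> Suc 0" "finite S"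
    using p(2) I by (simp_all add: S_def shape_def count_image_mset_set)
  then obtain i j where ij: "i \<in> S" "j \<in> S" "i \<noteq> j"
    by (auto simp: card_le_Suc0_iff_eq)
  have "k \<in> I \<and> Poly_Mapping.lookup e k = pval p" if "k \<in> S" for k
    using that p(1) is_dotted_var_entry[of k I e] pval_var_entry[of k I e] by (auto simp: S_def)
  with ij have m: "i \<in> I" "j \<in> I" "Poly_Mapping.lookup e i = Poly_Mapping.lookup e j" by auto
  define \<sigma> where "\<sigma> = Transposition.transpose i j"
  have \<sigma>: "bij \<sigma>" by (simp add: \<sigma>_def)
  have v: "\<sigma> -` I = I" "\<sigma> ` {i, j} = {i, j}" "\<sigma> ` (I - {i, j}) = I - {i, j}"
    using m by (auto simp: \<sigma>_def Transposition.transpose_def image_iff split: if_splits)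
  have e: "Poly_Mapping.map_key \<sigma> e = e"
    by (rule poly_mapping_eqI)
      (simp add: map_key.rep_eq[OF bij_is_inj[OF \<sigma>]] m(3), simp add: \<sigma>_def Transposition.transpose_def m(3))
  \<comment> \<open>Splitting off \<open>{i, j}\<close> leaves a set on which \<open>\<sigma>\<close> is the identity, so the whole sign of \<open>\<sigma>\<close> on
    \<open>I\<close> comes from this pair; the shuffle signs on both sides agree.\<close>
  have "perm_sign \<sigma> {i, j} = - 1"
    using ij(3) by (auto simp: perm_sign_def \<sigma>_def)
  moreover have "perm_sign \<sigma> (I - {i, j}) = 1"
    unfolding perm_sign_def by (intro prod.neutral ballI) (auto simp: \<sigma>_def Transposition.transpose_def)
  moreover have "{i, j} \<union> (I - {i, j}) = I" using m by auto
  ultimately have "perm_sign \<sigma> I * shuffle_sign {i, j} (I - {i, j}) = - shuffle_sign {i, j} (I - {i, j})"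
    using perm_sign_Un[OF \<sigma>, of "{i, j}" "I - {i, j}"] I by (simp only: v) simp
  then have "perm_sign \<sigma> I = - 1"
    using shuffle_sign_cases[of "{i, j}" "I - {i, j}"] by auto
  moreover have "coeff f I e = perm_sign \<sigma> I * coeff f I e"
    using coeff_permute_invariant[OF sSym_upto_permute[OF f \<sigma>] I, of e] by (simp only: v e)
  ultimately show ?thesis by simp
qed


section \<open>Power sums\<close>

definition theta_part :: "dpart \<Rightarrow> nat \<Rightarrow> nat set" where
  "theta_part p i = (if is_dotted p then {i} else {})"

text \<open>
  The power sums \<open>\<Sum>\<^sub>i x\<^sub>i\<^sup>n\<close> and \<open>\<Sum>\<^sub>i \<theta>\<^sub>i x\<^sub>i\<^sup>n\<close>, for the entries \<open>undotted n\<close> and \<open>dotted n\<close>.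
\<close>

lift_definition power_sum :: "dpart \<Rightarrow> superseries" is
  "\<lambda>p I e. if \<exists>i. I = theta_part p i \<and> e = Poly_Mapping.single i (pval p) then 1 else 0"
  by (auto simp: theta_part_def)

definition power_prod :: "dpart list \<Rightarrow> superseries" where
  "power_prod ps = prod_list (map power_sum ps)"

text \<open>The variables of \<open>\<theta>\<^sub>I x\<^sup>e\<close> from which the contribution of the entry \<open>p\<close> can be split off.\<close>

definition divisible_vars :: "dpart \<Rightarrow> nat set \<Rightarrow> (nat \<Rightarrow>\<^sub>0 nat) \<Rightarrow> nat set" where
  "divisible_vars p I e = {i \<in> vars I e. theta_part p i \<subseteq> I \<and> pval p \<le> Poly_Mapping.lookup e i}"

lemma single_add_diff:
  "k \<le> Poly_Mapping.lookup e i \<Longrightarrow> Poly_Mapping.single i k + (e - Poly_Mapping.single i k) = (e :: nat \<Rightarrow>\<^sub>0 nat)"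
  by (rule poly_mapping_eqI) (auto simp: lookup_add minus_poly_mapping.rep_eq lookup_single when_def)

lemma finite_theta_part [simp]: "finite (theta_part p i)"
  by (simp add: theta_part_def)

text \<open>
  Since every term of a power sum lives at a single variable \<open>i\<close>, a factorization of \<open>\<theta>\<^sub>I x\<^sup>e\<close> that
  contributes to the product amounts to the choice of \<open>i\<close>.
\<close>

lemma coeff_power_sum_mult:
  assumes I: "finite I"
  shows "coeff (power_sum p * f) I e = (\<Sum>i\<in>divisible_vars p I e.
    shuffle_sign (theta_part p i) (I - theta_part p i) *
    coeff f (I - theta_part p i) (e - Poly_Mapping.single i (pval p)))"
proof -
  let ?t = "\<lambda>((J, a), (K, b)). shuffle_sign J K * coeff (power_sum p) J a * coeff f K b"
  let ?z = "\<lambda>i. ((theta_part p i, Poly_Mapping.single i (pval p)),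
    (I - theta_part p i, e - Poly_Mapping.single i (pval p)))"
  have inj: "inj ?z"
  proof (rule injI)
    fix i j assume "?z i = ?z j"
    then have eq: "theta_part p i = theta_part p j" "Poly_Mapping.single i (pval p) = Poly_Mapping.single j (pval p)"
      by auto
    then have "Poly_Mapping.keys (Poly_Mapping.single i (pval p)) = Poly_Mapping.keys (Poly_Mapping.single j (pval p))"
      by simp
    with eq(1) show "i = j"
      using pval_pos[of p] by (auto simp: theta_part_def split: if_splits)
  qed
  have "coeff (power_sum p * f) I e = sum ?t (factorizations I e)"
    by (simp add: times_superseries.rep_eq)
  also have "\<dots> = sum ?t (?z ` divisible_vars p I e)"
  proof (rule sum.mono_neutral_right)
    show "?z ` divisible_vars p I e \<subseteq> factorizations I e"
      by (auto simp: factorizations_def divisible_vars_def single_add_diff)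
    show "\<forall>z\<in>factorizations I e - ?z ` divisible_vars p I e. ?t z = 0"
    proof
      fix z assume z: "z \<in> factorizations I e - ?z ` divisible_vars p I e"
      obtain J a K b where zz: "z = ((J, a), (K, b))" by (metis surj_pair)
      with z have f: "J \<inter> K = {}" "J \<union> K = I" "a + b = e" by (auto simp: factorizations_def)
      have "coeff (power_sum p) J a = 0"
      proof (rule ccontr)
        assume "coeff (power_sum p) J a \<noteq> 0"
        then obtain i where i: "J = theta_part p i" "a = Poly_Mapping.single i (pval p)"
          by (auto simp: power_sum.rep_eq split: if_splits)
        have "K = I - theta_part p i" "b = e - Poly_Mapping.single i (pval p)"
          using f i by auto
        then have "z = ?z i" using zz i by simp
        moreover have "pval p \<le> Poly_Mapping.lookup e i"
          using f(3) i(2) by (auto simp: lookup_add)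
        moreover have "i \<in> vars I e"
          using f i pval_pos[of p] \<open>pval p \<le> Poly_Mapping.lookup e i\<close>
          by (cases "is_dotted p") (auto simp: vars_def theta_part_def in_keys_iff)
        ultimately show False using z f i by (auto simp: divisible_vars_def)
      qed
      then show "?t z = 0" by (simp add: zz)
    qed
  qed (rule finite_factorizations[OF I])
  also have "\<dots> = (\<Sum>i\<in>divisible_vars p I e. ?t (?z i))"
    by (rule sum.reindex[unfolded comp_def]) (rule inj_on_subset[OF inj], simp)
  also have "\<dots> = (\<Sum>i\<in>divisible_vars p I e.
    shuffle_sign (theta_part p i) (I - theta_part p i) *
    coeff f (I - theta_part p i) (e - Poly_Mapping.single i (pval p)))"
    by (intro sum.cong refl) (auto simp: power_sum.rep_eq)
  finally show ?thesis .
qed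

lemma power_sum_sSym_upto: "power_sum p \<in> sSym_upto (entry_degree p)"
proof (rule sSym_uptoI)
  fix \<sigma> :: "nat \<Rightarrow> nat" assume \<sigma>: "bij \<sigma>"
  then have inj: "inj \<sigma>" by (rule bij_is_inj)
  define t where "t = inv \<sigma>"
  have t: "\<sigma> (t i) = i" "t (\<sigma> i) = i" for i
    using \<sigma> by (simp_all add: t_def bij_is_surj surj_f_inv_f bij_is_inj)
  have eq: "I = theta_part p (\<sigma> i) \<and> e = Poly_Mapping.single (\<sigma> i) (pval p) \<longleftrightarrow>
    \<sigma> -` I = theta_part p i \<and> Poly_Mapping.map_key \<sigma> e = Poly_Mapping.single i (pval p)" for I e i
  proof -
    have "\<sigma> ` theta_part p i = theta_part p (\<sigma> i)" by (simp add: theta_part_def)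
    then have "I = theta_part p (\<sigma> i) \<longleftrightarrow> \<sigma> -` I = theta_part p i"
      using inj_vimage_image_eq[OF inj] surj_image_vimage_eq[OF bij_is_surj[OF \<sigma>]] by metis
    moreover have "e = Poly_Mapping.single (\<sigma> i) (pval p) \<longleftrightarrow> Poly_Mapping.map_key \<sigma> e = Poly_Mapping.single i (pval p)"
    proof
      assume *: "Poly_Mapping.map_key \<sigma> e = Poly_Mapping.single i (pval p)"
      show "e = Poly_Mapping.single (\<sigma> i) (pval p)"
      proof (rule poly_mapping_eqI)
        fix k
        have "Poly_Mapping.lookup e (\<sigma> (t k)) = Poly_Mapping.lookup (Poly_Mapping.single i (pval p)) (t k)"
          using * by (metis comp_apply inj map_key.rep_eq)
        then show "Poly_Mapping.lookup e k = Poly_Mapping.lookup (Poly_Mapping.single (\<sigma> i) (pval p)) k"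
          using t by (auto simp: lookup_single when_def)
      qed
    qed (simp add: inj)
    ultimately show ?thesis by simp
  qed
  show "permute \<sigma> (power_sum p) = power_sum p"
  proof (rule superseries_eqI)
    fix I e assume I: "finite (I :: nat set)"
    have "(\<exists>i. \<sigma> -` I = theta_part p i \<and> Poly_Mapping.map_key \<sigma> e = Poly_Mapping.single i (pval p)) \<longleftrightarrow>
        (\<exists>i. I = theta_part p i \<and> e = Poly_Mapping.single i (pval p))"
      by (metis eq t(1))
    moreover have "perm_sign \<sigma> (theta_part p i) = 1" for i
      by (auto simp: perm_sign_def theta_part_def)
    ultimately show "coeff (permute \<sigma> (power_sum p)) I e = coeff (power_sum p) I e"
      using I by (auto simp: permute.rep_eq power_sum.rep_eq)
  qed
qed (auto simp: power_sum.rep_eq entry_degree_def theta_part_def split: if_splits)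

lemma power_prod_sSym_upto: "power_prod ps \<in> sSym_upto (\<Sum>p\<leftarrow>ps. entry_degree p)"
  unfolding power_prod_def by (rule sSym_upto_prod_list) (rule power_sum_sSym_upto)


section \<open>Monomials with prescribed entries\<close>

text \<open>The monomial in which the entry \<open>ps ! k\<close> is placed at the variable \<open>is ! k\<close>.\<close>

definition thetas_at :: "nat list \<Rightarrow> dpart list \<Rightarrow> nat set" where
  "thetas_at is ps = (!) is ` {k. k < length ps \<and> is_dotted (ps ! k)}"

definition exps_at :: "nat list \<Rightarrow> dpart list \<Rightarrow> nat \<Rightarrow>\<^sub>0 nat" where
  "exps_at is ps = (\<Sum>k<length ps. Poly_Mapping.single (is ! k) (pval (ps ! k)))"

lemma finite_thetas_at [simp]: "finite (thetas_at is ps)"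
  by (simp add: thetas_at_def)

lemma lookup_exps_at:
  "Poly_Mapping.lookup (exps_at is ps) i = (\<Sum>k<length ps. if is ! k = i then pval (ps ! k) else 0)"
  by (simp add: exps_at_def lookup_sum lookup_single when_def)

lemma lookup_exps_at_nth:
  assumes "distinct is" "length is = length ps" "k < length ps"
  shows "Poly_Mapping.lookup (exps_at is ps) (is ! k) = pval (ps ! k)"
proof -
  have "(\<Sum>j<length ps. if is ! j = is ! k then pval (ps ! j) else 0) =
      (\<Sum>j<length ps. if j = k then pval (ps ! j) else 0)"
    using assms by (intro sum.cong refl) (simp add: nth_eq_iff_index_eq)
  then show ?thesis using assms(3) by (simp add: lookup_exps_at)
qed

lemma nth_in_thetas_at:
  assumes "distinct is" "length is = length ps" "k < length ps"
  shows "is ! k \<in> thetas_at is ps \<longleftrightarrow> is_dotted (ps ! k)"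
  using assms by (auto simp: thetas_at_def nth_eq_iff_index_eq)

lemma vars_at:
  assumes "distinct is" "length is = length ps"
  shows "vars (thetas_at is ps) (exps_at is ps) = set is"
proof
  show "vars (thetas_at is ps) (exps_at is ps) \<subseteq> set is"
    using assms by (auto simp: vars_def thetas_at_def in_keys_iff lookup_exps_at split: if_splits)
  show "set is \<subseteq> vars (thetas_at is ps) (exps_at is ps)"
  proof
    fix i assume "i \<in> set is"
    then obtain k where k: "k < length ps" "i = is ! k" using assms by (auto simp: in_set_conv_nth)
    then show "i \<in> vars (thetas_at is ps) (exps_at is ps)"
      using pval_pos[of "ps ! k"] nth_in_thetas_at[OF assms k(1)] lookup_exps_at_nth[OF assms k(1)]
      by (cases "is_dotted (ps ! k)") (auto simp: vars_def in_keys_iff)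
  qed
qed

lemma shape_at:
  assumes "distinct is" "length is = length ps"
  shows "shape (thetas_at is ps) (exps_at is ps) = mset ps"
proof -
  have "map (var_entry (thetas_at is ps) (exps_at is ps)) is = ps"
    by (rule nth_equalityI)
      (use assms in \<open>auto simp: var_entry_def nth_in_thetas_at lookup_exps_at_nth dotted_pval undotted_pval\<close>)
  then show ?thesis
    using assms by (simp add: shape_def vars_at mset_set_set flip: mset_map)
qed

text \<open>
  A monomial of the given shape is the image of the one with entries at the variables
  \<open>0, 1, 2, \<dots>\<close> under some permutation of the variables.
\<close>

lemma monomial_of_shape:
  assumes "finite I" "shape I e = mset ps"
  obtains "is" where "distinct is" "length is = length ps" "I = thetas_at is ps" "e = exps_at is ps"
proof -
  let ?o = "[0..<length ps]"
  have "shape (thetas_at ?o ps) (exps_at ?o ps) = shape I e"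
    using assms by (simp add: shape_at)
  then obtain \<sigma> where \<sigma>: "bij \<sigma>" "thetas_at ?o ps = \<sigma> -` I" "exps_at ?o ps = Poly_Mapping.map_key \<sigma> e"
    by (rule shape_eq_permutation[OF finite_thetas_at assms(1)])
  have inj: "inj \<sigma>" using \<sigma>(1) by (rule bij_is_inj)
  have "distinct (map \<sigma> ?o)" using inj by (simp add: distinct_map inj_on_def)
  moreover have "I = thetas_at (map \<sigma> ?o) ps"
  proof -
    have "I = \<sigma> ` thetas_at ?o ps" using \<sigma> by (simp add: bij_is_surj surj_image_vimage_eq)
    also have "\<dots> = thetas_at (map \<sigma> ?o) ps"
      unfolding thetas_at_def image_image by (intro image_cong) auto
    finally show ?thesis .
  qed
  moreover have "e = exps_at (map \<sigma> ?o) ps"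
  proof (rule poly_mapping_eqI)
    fix x
    obtain y where y: "x = \<sigma> y" using \<sigma>(1) by (metis bij_pointE)
    have "Poly_Mapping.lookup e x = Poly_Mapping.lookup (exps_at ?o ps) y"
      by (simp add: \<sigma>(3) map_key.rep_eq[OF inj] y)
    also have "\<dots> = Poly_Mapping.lookup (exps_at (map \<sigma> ?o) ps) x"
      by (simp add: lookup_exps_at y inj_eq[OF inj])
    finally show "Poly_Mapping.lookup e x = Poly_Mapping.lookup (exps_at (map \<sigma> ?o) ps) x" .
  qed
  ultimately show ?thesis using that[of "map \<sigma> ?o"] by simp
qed


section \<open>Products of power sums, by number of variables\<close>

lemma vars_mult: "vars (J \<union> K) (a + b) = vars J a \<union> vars K b"
  by (auto simp: vars_def in_keys_iff lookup_add)

lemma vars_power_sum: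
  assumes "coeff (power_sum p) J a \<noteq> 0" shows "card (vars J a) \<le> 1"
proof -
  obtain i where "J = theta_part p i" "a = Poly_Mapping.single i (pval p)"
    using assms by (auto simp: power_sum.rep_eq split: if_splits)
  then have "vars J a \<subseteq> {i}" by (auto simp: vars_def theta_part_def split: if_splits)
  then show ?thesis using card_mono[of "{i}" "vars J a"] by simp
qed

lemma card_vars_power_prod:
  "coeff (power_prod ps) I e \<noteq> 0 \<Longrightarrow> card (vars I e) \<le> length ps"
proof (induction ps arbitrary: I e)
  case Nil
  then show ?case by (auto simp: power_prod_def one_superseries.rep_eq vars_def split: if_splits)
next
  case (Cons p ps)
  from Cons.prems have "coeff (power_sum p * power_prod ps) I e \<noteq> 0" by (simp add: power_prod_def)
  then obtain J K a b where "I = J \<union> K" "e = a + b" "coeff (power_sum p) J a \<noteq> 0" "coeff (power_prod ps) K b \<noteq> 0"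
    by (rule coeff_mult_nonzeroE)
  with Cons.IH[of K b] vars_power_sum[of p J a] card_Un_le[of "vars J a" "vars K b"]
  show ?case by (simp add: vars_mult)
qed

lemma var_entry_remove:
  assumes I: "finite I" and i: "i \<in> vars I e" "var_entry I e i = p"
  shows "vars (I - theta_part p i) (e - Poly_Mapping.single i (pval p)) = vars I e - {i}"
    and "shape I e = add_mset p (shape (I - theta_part p i) (e - Poly_Mapping.single i (pval p)))"
proof -
  let ?I = "I - theta_part p i" and ?e = "e - Poly_Mapping.single i (pval p)"
  have p: "is_dotted p \<longleftrightarrow> i \<in> I" "pval p = Poly_Mapping.lookup e i"
    using i is_dotted_var_entry pval_var_entry by blast+
  have at_i: "i \<notin> ?I" "Poly_Mapping.lookup ?e i = 0"
    using p by (auto simp: theta_part_def minus_poly_mapping.rep_eq)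
  have off_i: "j \<in> ?I \<longleftrightarrow> j \<in> I" "Poly_Mapping.lookup ?e j = Poly_Mapping.lookup e j" if "j \<noteq> i" for j
    using that by (auto simp: theta_part_def minus_poly_mapping.rep_eq lookup_single)
  show v: "vars ?I ?e = vars I e - {i}"
  proof (rule set_eqI)
    fix j
    show "j \<in> vars ?I ?e \<longleftrightarrow> j \<in> vars I e - {i}"
      by (cases "j = i") (use at_i off_i[of j] in \<open>auto simp: vars_def in_keys_iff\<close>)
  qed
  have "mset_set (vars I e) = add_mset i (mset_set (vars I e - {i}))"
    using I i by (simp add: mset_set.remove)
  then have "shape I e = add_mset p (image_mset (var_entry I e) (mset_set (vars I e - {i})))"
    by (simp add: shape_def i)
  also have "image_mset (var_entry I e) (mset_set (vars I e - {i})) = shape ?I ?e"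
    unfolding shape_def v by (rule image_mset_cong) (use I off_i in \<open>auto simp: var_entry_def\<close>)
  finally show "shape I e = add_mset p (shape ?I ?e)" .
qed

text \<open>
  When a product of \<open>l\<close> power sums is evaluated at a monomial in \<open>l\<close> variables, each factor has to
  use up its variable completely: otherwise the remaining \<open>l - 1\<close> factors would have to account for
  \<open>l\<close> variables.
\<close>

lemma coeff_power_prod_Cons:
  assumes I: "finite I" and card: "card (vars I e) = Suc (length ps)"
  shows "coeff (power_prod (p # ps)) I e = (\<Sum>i | i \<in> vars I e \<and> var_entry I e i = p.
    shuffle_sign (theta_part p i) (I - theta_part p i) *
    coeff (power_prod ps) (I - theta_part p i) (e - Poly_Mapping.single i (pval p)))"
proof -
  let ?t = "\<lambda>i. shuffle_sign (theta_part p i) (I - theta_part p i) *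
    coeff (power_prod ps) (I - theta_part p i) (e - Poly_Mapping.single i (pval p))"
  have "coeff (power_prod (p # ps)) I e = sum ?t (divisible_vars p I e)"
    using coeff_power_sum_mult[OF I] by (simp add: power_prod_def)
  also have "\<dots> = sum ?t {i. i \<in> vars I e \<and> var_entry I e i = p}"
  proof (rule sum.mono_neutral_right)
    show "finite (divisible_vars p I e)" using I by (simp add: divisible_vars_def)
    show "{i. i \<in> vars I e \<and> var_entry I e i = p} \<subseteq> divisible_vars p I e"
      using is_dotted_var_entry pval_var_entry by (force simp: divisible_vars_def theta_part_def)
    show "\<forall>i\<in>divisible_vars p I e - {i. i \<in> vars I e \<and> var_entry I e i = p}. ?t i = 0"
    proof
      fix i assume i: "i \<in> divisible_vars p I e - {i. i \<in> vars I e \<and> var_entry I e i = p}"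
      let ?I = "I - theta_part p i" and ?e = "e - Poly_Mapping.single i (pval p)"
      from i have iv: "i \<in> vars I e" and ne: "var_entry I e i \<noteq> p"
        and sub: "theta_part p i \<subseteq> I" and le: "pval p \<le> Poly_Mapping.lookup e i"
        by (auto simp: divisible_vars_def)
      have "i \<in> vars ?I ?e"
      proof (rule ccontr)
        assume "i \<notin> vars ?I ?e"
        then have "i \<notin> ?I" "Poly_Mapping.lookup ?e i = 0" by (auto simp: vars_def in_keys_iff)
        then have "is_dotted p \<longleftrightarrow> i \<in> I" "pval p = Poly_Mapping.lookup e i"
          using sub le by (auto simp: theta_part_def minus_poly_mapping.rep_eq split: if_splits)
        then have "var_entry I e i = p"
          by (intro dpart_eqI) (simp_all add: is_dotted_var_entry[OF iv] pval_var_entry[OF iv])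
        with ne show False ..
      qed
      then have "vars I e \<subseteq> vars ?I ?e"
        by (auto simp: vars_def theta_part_def in_keys_iff minus_poly_mapping.rep_eq lookup_single when_def split: if_splits)
      then have "card (vars I e) \<le> card (vars ?I ?e)"
        using I by (intro card_mono) auto
      then have "coeff (power_prod ps) ?I ?e = 0"
        using card card_vars_power_prod[of ps ?I ?e] by (metis Suc_n_not_le_n order_trans)
      then show "?t i = 0" by simp
    qed
  qed
  finally show ?thesis .
qed

lemma coeff_power_prod_other_shape:
  "finite I \<Longrightarrow> card (vars I e) = length ps \<Longrightarrow> shape I e \<noteq> mset ps \<Longrightarrow> coeff (power_prod ps) I e = 0"
proof (induction ps arbitrary: I e)
  case Nil
  then show ?case by (simp add: shape_def)
next
  case (Cons p ps)
  have "coeff (power_prod ps) (I - theta_part p i) (e - Poly_Mapping.single i (pval p)) = 0"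
    if "i \<in> vars I e" "var_entry I e i = p" for i
    using var_entry_remove[OF Cons.prems(1) that] Cons.prems that
    by (intro Cons.IH) auto
  then show ?case
    using Cons.prems by (subst coeff_power_prod_Cons) auto
qed

lemma coeff_power_prod_undotted_pos:
  "finite I \<Longrightarrow> shape I e = mset ps \<Longrightarrow> \<forall>p\<in>set ps. \<not> is_dotted p \<Longrightarrow> coeff (power_prod ps) I e > 0"
proof (induction ps arbitrary: I e)
  case Nil
  then have "I = {}" "e = 0"
    by (simp_all add: shape_def mset_set_empty_iff vars_def)
  then show ?case by (simp add: power_prod_def one_superseries.rep_eq)
next
  case (Cons p ps)
  have card: "card (vars I e) = Suc (length ps)"
    using Cons.prems(2) size_shape[of I e] by simp
  have p: "theta_part p i = {}" for i using Cons.prems by (simp add: theta_part_def)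
  have "p \<in># shape I e" using Cons.prems by simp
  then have "{i. i \<in> vars I e \<and> var_entry I e i = p} \<noteq> {}"
    using Cons.prems(1) by (auto simp: shape_def)
  moreover have "coeff (power_prod ps) I (e - Poly_Mapping.single i (pval p)) > 0"
    if "i \<in> vars I e" "var_entry I e i = p" for i
    using var_entry_remove(2)[OF Cons.prems(1) that] Cons.prems p by (intro Cons.IH) auto
  ultimately show ?case
    using Cons.prems(1) by (subst coeff_power_prod_Cons[OF _ card]) (auto simp: p intro!: sum_pos)
qed

text \<open>
  Distinct dotted entries leave no choice for the variables they are taken from, so that no
  cancellation can occur among the signs; the undotted entries contribute positively.
\<close>

lemma coeff_power_prod_same_shape:
  "finite I \<Longrightarrow> shape I e = mset (ds @ us) \<Longrightarrow> dots_distinct (shape I e) \<Longrightarrow>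
    \<forall>p\<in>set ds. is_dotted p \<Longrightarrow> \<forall>p\<in>set us. \<not> is_dotted p \<Longrightarrow> coeff (power_prod (ds @ us)) I e \<noteq> 0"
proof (induction ds arbitrary: I e)
  case Nil
  then show ?case using coeff_power_prod_undotted_pos[of I e us] by simp
next
  case (Cons p ds)
  have card: "card (vars I e) = Suc (length (ds @ us))"
    using Cons.prems(2) size_shape[of I e] by simp
  define S where "S = {i. i \<in> vars I e \<and> var_entry I e i = p}"
  have "card S = count (shape I e) p"
    using Cons.prems(1) by (simp add: S_def shape_def count_image_mset_set)
  moreover have "count (shape I e) p \<le> 1"
    using Cons.prems(3,4) by (simp add: dots_distinct_def)
  ultimately have "card S = 1"
    using Cons.prems(2) by simp
  then obtain i where S: "S = {i}" by (auto simp: card_1_singleton_iff)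
  then have i: "i \<in> vars I e" "var_entry I e i = p" by (auto simp: S_def)
  let ?I = "I - theta_part p i" and ?e = "e - Poly_Mapping.single i (pval p)"
  have sh: "shape I e = add_mset p (shape ?I ?e)"
    using var_entry_remove(2)[OF Cons.prems(1) i] .
  then have "dots_distinct (shape ?I ?e)"
    using Cons.prems(3) unfolding dots_distinct_def by (metis count_add_mset le_SucI Suc_leD)
  then have "coeff (power_prod (ds @ us)) ?I ?e \<noteq> 0"
    using Cons.prems sh by (intro Cons.IH) auto
  moreover have "coeff (power_prod ((p # ds) @ us)) I e =
      shuffle_sign (theta_part p i) ?I * coeff (power_prod (ds @ us)) ?I ?e"
    using coeff_power_prod_Cons[OF Cons.prems(1) card, of p] S by (simp add: S_def)
  ultimately show ?case
    using shuffle_sign_cases[of "theta_part p i" ?I] by auto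
qed


section \<open>The basis of power sums\<close>

abbreviation superpower :: "spart \<Rightarrow> superseries" where
  "superpower \<Lambda> \<equiv> power_prod (entries (dcomp_of \<Lambda>))"

definition mset_degree :: "dpart multiset \<Rightarrow> nat" where
  "mset_degree M = sum_mset (image_mset entry_degree M)"

definition spart_upto :: "nat \<Rightarrow> spart set" where
  "spart_upto d = {\<Lambda>. superpartition \<Lambda> \<and> mset_degree (entry_mset \<Lambda>) \<le> d}"

lemma mset_degree_entry_mset:
  assumes "superpartition \<Lambda>"
  shows "mset_degree (entry_mset \<Lambda>) = spsize \<Lambda> + df \<Lambda>"
proof -
  have "(\<Sum>n\<leftarrow>ns. entry_degree (dotted n)) = sum_list ns + length ns" for ns
    by (induction ns) (auto simp: entry_degree_def)
  moreover have "\<forall>n\<in>set ns. 1 \<le> n \<Longrightarrow> (\<Sum>n\<leftarrow>ns. entry_degree (undotted n)) = sum_list ns" for ns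
    by (induction ns) (auto simp: entry_degree_def)
  ultimately show ?thesis
    using assms by (simp add: mset_degree_def entry_mset_eq spsize_def sparts_def df_def superpartition_def
        multiset.map_comp comp_def sum_mset_sum_list flip: mset_map)
qed

lemma finite_spart_upto: "finite (spart_upto d)"
proof -
  have "spart_upto d \<subseteq> (\<Union>r\<le>d. \<Union>m\<le>d. {\<Lambda>. superpartition \<Lambda> \<and> spsize \<Lambda> = r \<and> df \<Lambda> = m})"
    by (auto simp: spart_upto_def mset_degree_entry_mset)
  then show ?thesis by (rule finite_subset) (simp add: finite_superpartitions)
qed

lemma entry_mset_size: "size (entry_mset \<Lambda>) = length (entries (dcomp_of \<Lambda>))"
  by (simp add: entry_mset_def)

lemma superpower_sSym_upto: "superpower \<Lambda> \<in> sSym_upto (mset_degree (entry_mset \<Lambda>))"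
  using power_prod_sSym_upto[of "entries (dcomp_of \<Lambda>)"]
  by (simp add: mset_degree_def entry_mset_def sum_mset_sum_list flip: mset_map)

lemma coeff_superpower_same_shape:
  assumes "superpartition \<Lambda>" "finite I" "shape I e = entry_mset \<Lambda>"
  shows "coeff (superpower \<Lambda>) I e \<noteq> 0"
  using coeff_power_prod_same_shape[of I e "map dotted (fst \<Lambda>)" "map undotted (snd \<Lambda>)"] assms
    dots_distinct_entry_mset[OF assms(1)]
  by (auto simp: entry_mset_def dcomp_of_def superpartition_def)

lemma coeff_superpower_other_shape:
  assumes "finite I" "size (entry_mset \<Lambda>) \<le> card (vars I e)" "shape I e \<noteq> entry_mset \<Lambda>"
  shows "coeff (superpower \<Lambda>) I e = 0"
  using assms card_vars_power_prod[of "entries (dcomp_of \<Lambda>)" I e]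
    coeff_power_prod_other_shape[of I e "entries (dcomp_of \<Lambda>)"]
  by (force simp: entry_mset_size entry_mset_def)

lemma coeff_sum: "coeff (\<Sum>x\<in>A. f x) I e = (\<Sum>x\<in>A. coeff (f x) I e)"
  by (induction A rule: infinite_finite_induct) (auto simp: zero_superseries.rep_eq plus_superseries.rep_eq)

lemma ex_monomial_of_superpartition: "\<exists>I e. finite I \<and> shape I e = entry_mset \<Lambda>"
proof (intro exI conjI)
  let ?ps = "entries (dcomp_of \<Lambda>)"
  show "shape (thetas_at [0..<length ?ps] ?ps) (exps_at [0..<length ?ps] ?ps) = entry_mset \<Lambda>"
    by (simp add: shape_at entry_mset_def)
qed simp

text \<open>
  Among the superpartitions with a nonzero coefficient, take one with the most parts.  A monomial
  of its shape occurs in the power sum product of no other one among these.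
\<close>

lemma superpower_sum_zero:
  assumes T: "finite T" "\<forall>\<Lambda>\<in>T. superpartition \<Lambda>"
    and z: "(\<Sum>\<Lambda>\<in>T. scale (c \<Lambda>) (superpower \<Lambda>)) = 0"
  shows "\<forall>\<Lambda>\<in>T. c \<Lambda> = 0"
proof (rule ccontr)
  assume "\<not> ?thesis"
  then have ne: "{\<Lambda>\<in>T. c \<Lambda> \<noteq> 0} \<noteq> {}" by auto
  define l where "l = Max ((\<lambda>\<Lambda>. size (entry_mset \<Lambda>)) ` {\<Lambda>\<in>T. c \<Lambda> \<noteq> 0})"
  have "l \<in> (\<lambda>\<Lambda>. size (entry_mset \<Lambda>)) ` {\<Lambda>\<in>T. c \<Lambda> \<noteq> 0}"
    unfolding l_def using ne T by (intro Max_in) auto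
  then obtain \<Lambda> where \<Lambda>: "\<Lambda> \<in> T" "c \<Lambda> \<noteq> 0" "size (entry_mset \<Lambda>) = l" by auto
  have l: "size (entry_mset M) \<le> l" if "M \<in> T" "c M \<noteq> 0" for M
    unfolding l_def using T that by (intro Max_ge) auto
  obtain I e where Ie: "finite I" "shape I e = entry_mset \<Lambda>"
    using ex_monomial_of_superpartition by blast
  have "c M * coeff (superpower M) I e = 0" if "M \<in> T" "M \<noteq> \<Lambda>" for M
  proof (cases "c M = 0")
    case False
    have "entry_mset M \<noteq> entry_mset \<Lambda>" using that T \<Lambda> entry_mset_inj by blast
    then have "coeff (superpower M) I e = 0"
      using Ie l[OF that(1) False] \<Lambda> size_shape[of I e] by (intro coeff_superpower_other_shape) auto
    then show ?thesis by simp
  qed simp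
  then have "(\<Sum>M\<in>T - {\<Lambda>}. c M * coeff (superpower M) I e) = 0"
    by (intro sum.neutral) auto
  then have "coeff (\<Sum>\<Lambda>\<in>T. scale (c \<Lambda>) (superpower \<Lambda>)) I e = c \<Lambda> * coeff (superpower \<Lambda>) I e"
    unfolding coeff_sum scale.rep_eq using T(1) \<Lambda>(1) by (simp add: sum.remove)
  with z \<Lambda> coeff_superpower_same_shape[OF _ Ie] T show False
    by (auto simp: zero_superseries.rep_eq)
qed

lemma inj_on_superpower: "inj_on superpower {\<Lambda>. superpartition \<Lambda>}"
proof (rule inj_onI, rule ccontr)
  fix \<Lambda> M assume *: "\<Lambda> \<in> {\<Lambda>. superpartition \<Lambda>}" "M \<in> {\<Lambda>. superpartition \<Lambda>}"
    "superpower \<Lambda> = superpower M" "\<Lambda> \<noteq> M"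
  then have "(\<Sum>N\<in>{\<Lambda>, M}. scale (if N = \<Lambda> then 1 else - 1) (superpower N)) = 0"
    by (auto simp: superspace.scale_minus_left)
  from superpower_sum_zero[OF _ _ this] * show False by auto
qed

lemma independent_superpower:
  assumes "finite T" "\<forall>\<Lambda>\<in>T. superpartition \<Lambda>"
  shows "superspace.independent (superpower ` T)"
proof -
  have "inj_on superpower T" using assms by (auto intro: inj_on_subset[OF inj_on_superpower])
  then show ?thesis
    using assms superpower_sum_zero[OF assms]
    by (simp add: superspace.dependent_finite sum.reindex comp_def) metis
qed

text \<open>
  Subtracting suitable multiples of the products of \<open>l\<close> power sums removes from a symmetric series
  all monomials in \<open>l\<close> variables, and adds only monomials in fewer variables.
\<close>

lemma in_span_superpower_width:
  "f \<in> sSym_upto d \<Longrightarrow> (\<And>I e. coeff f I e \<noteq> 0 \<Longrightarrow> card (vars I e) < l) \<Longrightarrow>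
    f \<in> superspace.span (superpower ` spart_upto d)"
proof (induction l arbitrary: f)
  case 0
  then have "f = 0" by (intro superseries_eqI) (auto simp: zero_superseries.rep_eq)
  then show ?case by (simp add: superspace.span_zero)
next
  case (Suc l)
  note f = Suc.prems(1)
  obtain J a where Ja: "finite (J \<Lambda>)" "shape (J \<Lambda>) (a \<Lambda>) = entry_mset \<Lambda>" for \<Lambda>
    using ex_monomial_of_superpartition by metis
  define T where "T = {\<Lambda> \<in> spart_upto d. size (entry_mset \<Lambda>) = l}"
  \<comment> \<open>The multiple of \<open>superpower \<Lambda>\<close> that cancels the coefficient of \<open>f\<close> at the chosen monomial of
    shape \<open>\<Lambda>\<close>; by symmetry it cancels all monomials of this shape.\<close>
  define c where "c \<Lambda> = coeff f (J \<Lambda>) (a \<Lambda>) / coeff (superpower \<Lambda>) (J \<Lambda>) (a \<Lambda>)" for \<Lambda>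
  define s where "s = (\<Sum>\<Lambda>\<in>T. scale (c \<Lambda>) (superpower \<Lambda>))"
  have T: "finite T" "\<Lambda> \<in> T \<Longrightarrow> superpartition \<Lambda>" for \<Lambda>
    using finite_subset[OF _ finite_spart_upto[of d], of T] by (auto simp: T_def spart_upto_def)
  have "s \<in> sSym_upto d"
    unfolding s_def
  proof (intro superspace.subspace_sum superspace.subspace_scale subspace_sSym_upto)
    fix \<Lambda> assume "\<Lambda> \<in> T"
    then show "superpower \<Lambda> \<in> sSym_upto d"
      using superpower_sSym_upto[of \<Lambda>] sSym_upto_mono[of "mset_degree (entry_mset \<Lambda>)" d]
      by (auto simp: T_def spart_upto_def)
  qed
  then have g: "f - s \<in> sSym_upto d"
    using f by (intro superspace.subspace_diff subspace_sSym_upto)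
  have coeff_g: "coeff (f - s) I e = coeff f I e - (\<Sum>\<Lambda>\<in>T. c \<Lambda> * coeff (superpower \<Lambda>) I e)" for I e
    by (simp add: s_def minus_superseries.rep_eq coeff_sum scale.rep_eq)
  have at_J: "coeff (f - s) (J \<Lambda>) (a \<Lambda>) = 0" if \<Lambda>: "\<Lambda> \<in> T" for \<Lambda>
  proof -
    have "coeff (superpower M) (J \<Lambda>) (a \<Lambda>) = 0" if "M \<in> T - {\<Lambda>}" for M
    proof (rule coeff_superpower_other_shape)
      show "shape (J \<Lambda>) (a \<Lambda>) \<noteq> entry_mset M"
        using that \<Lambda> T entry_mset_inj Ja by (metis DiffE singletonI)
    qed (use Ja that \<Lambda> size_shape[of "J \<Lambda>" "a \<Lambda>"] in \<open>auto simp: T_def\<close>)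
    then have "(\<Sum>M\<in>T. c M * coeff (superpower M) (J \<Lambda>) (a \<Lambda>)) = c \<Lambda> * coeff (superpower \<Lambda>) (J \<Lambda>) (a \<Lambda>)"
      using T \<Lambda> by (simp add: sum.remove)
    also have "\<dots> = coeff f (J \<Lambda>) (a \<Lambda>)"
      using coeff_superpower_same_shape[OF T(2)[OF \<Lambda>] Ja] by (simp add: c_def)
    finally show ?thesis by (simp add: coeff_g)
  qed
  have "f - s \<in> superspace.span (superpower ` spart_upto d)"
  proof (rule Suc.IH[OF g], rule ccontr)
    fix I e assume nz: "coeff (f - s) I e \<noteq> 0" and ge: "\<not> card (vars I e) < l"
    have I: "finite I" using nz by (metis coeff_infinite)
    have "card (vars I e) = l"
    proof (rule ccontr)
      assume "card (vars I e) \<noteq> l"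
      with ge have gt: "l < card (vars I e)" by simp
      then have "coeff f I e = 0" using Suc.prems(2)[of I e] by auto
      moreover have "coeff (superpower \<Lambda>) I e = 0" if "\<Lambda> \<in> T" for \<Lambda>
        using that gt card_vars_power_prod[of "entries (dcomp_of \<Lambda>)" I e]
        by (force simp: T_def entry_mset_size)
      ultimately show False using nz by (simp add: coeff_g)
    qed
    moreover have "dots_distinct (shape I e)"
      using nz coeff_repeated_dots[OF g I] by blast
    then obtain \<Lambda> where \<Lambda>: "superpartition \<Lambda>" "entry_mset \<Lambda> = shape I e"
      by (rule superpartition_with_entries)
    moreover have "mset_degree (shape I e) \<le> d"
      using degree_shape[OF I] sSym_upto_degree[OF g nz] by (simp add: mset_degree_def)
    ultimately have "\<Lambda> \<in> T"
      by (simp add: T_def spart_upto_def size_shape)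
    from at_J[OF this] nz show False
      using coeff_eq_zero_iff_shape_eq[OF g I Ja(1)] \<Lambda>(2) Ja(2) by metis
  qed
  moreover have "s \<in> superspace.span (superpower ` spart_upto d)"
    unfolding s_def
    by (intro superspace.span_sum superspace.span_scale superspace.span_base) (auto simp: T_def)
  ultimately have "(f - s) + s \<in> superspace.span (superpower ` spart_upto d)"
    by (rule superspace.span_add)
  then show ?case by simp
qed

lemma card_keys_le_exp_degree: "card (Poly_Mapping.keys e) \<le> exp_degree e"
  unfolding exp_degree_def using sum_mono[of "Poly_Mapping.keys e" "\<lambda>_. 1" "Poly_Mapping.lookup e"]
  by (simp add: in_keys_iff Suc_le_eq)

lemma in_span_superpower:
  assumes "f \<in> sSym_upto d"
  shows "f \<in> superspace.span (superpower ` spart_upto d)"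
proof (rule in_span_superpower_width[OF assms])
  fix I e assume "coeff f I e \<noteq> 0"
  with assms have "card I + exp_degree e \<le> d" by (rule sSym_upto_degree)
  then show "card (vars I e) < Suc d"
    using card_Un_le[of I "Poly_Mapping.keys e"] card_keys_le_exp_degree[of e] by (simp add: vars_def)
qed


section \<open>Coefficients of the complete symmetric functions\<close>

lemma xvar_power: "xvar i ^ k = smonom {} (Poly_Mapping.single i k)"
  by (induction k) (simp_all add: smonom_one xvar_def smonom_mult flip: single_add)

lemma prod_xvar_powers:
  "prod_list (map2 (\<lambda>i k. xvar i ^ k) is ks) = smonom {} (\<Sum>(i, k)\<leftarrow>zip is ks. Poly_Mapping.single i k)"
  by (induction "is" ks rule: list_induct2') (simp_all add: smonom_one xvar_power smonom_mult)

lemma map_pval_dcomp_of: "superpartition \<Lambda> \<Longrightarrow> map pval (entries (dcomp_of \<Lambda>)) = sparts \<Lambda>"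
  by (auto simp: dcomp_of_def sparts_def superpartition_def intro!: map_idI)

lemma is_dotted_nth_dcomp_of:
  "superpartition \<Lambda> \<Longrightarrow> k < length (sparts \<Lambda>) \<Longrightarrow> is_dotted (entries (dcomp_of \<Lambda>) ! k) \<longleftrightarrow> k < df \<Lambda>"
  by (auto simp: dcomp_of_def sparts_def superpartition_def df_def nth_append)

lemma sterm_eq_smonom:
  assumes \<Lambda>: "superpartition \<Lambda>" "df \<Lambda> \<le> 1" and len: "length is = length (sparts \<Lambda>)"
  shows "sterm \<Lambda> is = smonom (thetas_at is (entries (dcomp_of \<Lambda>))) (exps_at is (entries (dcomp_of \<Lambda>)))"
proof -
  let ?ps = "entries (dcomp_of \<Lambda>)"
  have lps: "length ?ps = length (sparts \<Lambda>)" by (simp add: dcomp_of_def sparts_def)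
  have dfl: "df \<Lambda> \<le> length (sparts \<Lambda>)" by (simp add: df_def sparts_def)
  have "exps_at is ?ps = (\<Sum>k<length ?ps. Poly_Mapping.single (is ! k) (sparts \<Lambda> ! k))"
    unfolding exps_at_def by (intro sum.cong refl) (simp add: nth_map[symmetric] map_pval_dcomp_of[OF \<Lambda>(1)] del: nth_map)
  also have "\<dots> = (\<Sum>(i, k)\<leftarrow>zip is (sparts \<Lambda>). Poly_Mapping.single i k)"
    using len lps by (simp add: sum_list_sum_nth atLeast0LessThan)
  finally have e: "(\<Sum>(i, k)\<leftarrow>zip is (sparts \<Lambda>). Poly_Mapping.single i k) = exps_at is ?ps" by simp
  have "{k. k < length ?ps \<and> is_dotted (?ps ! k)} = {0..<df \<Lambda>}"
    using dfl by (auto simp: lps is_dotted_nth_dcomp_of[OF \<Lambda>(1)])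
  then have I: "thetas_at is ?ps = set (take (df \<Lambda>) is)"
    using len dfl by (simp add: thetas_at_def nth_image)
  have "prod_list (map theta (take (df \<Lambda>) is)) = smonom (set (take (df \<Lambda>) is)) 0"
  proof (cases "df \<Lambda> = 0")
    case False
    then have "df \<Lambda> = 1" using \<Lambda>(2) by simp
    moreover obtain j js where "is = j # js" using dfl len \<open>df \<Lambda> = 1\<close> by (cases "is") auto
    ultimately show ?thesis by (simp add: theta_def)
  qed (simp add: smonom_one)
  then show ?thesis
    by (simp add: sterm_def prod_xvar_powers e I smonom_mult)
qed

text \<open>With at most one \<open>\<theta>\<close> there is nothing to sort, so all coefficients of \<open>m\<^sub>\<Lambda>\<close> are \<open>0\<close> or \<open>1\<close>.\<close>

lemma coeff_m_fun:
  assumes \<Lambda>: "superpartition \<Lambda>" "df \<Lambda> \<le> 1" and I: "finite I"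
  shows "coeff (m_fun \<Lambda>) I e = of_bool (shape I e = entry_mset \<Lambda>)"
proof -
  let ?ps = "entries (dcomp_of \<Lambda>)"
  have lps: "length ?ps = length (sparts \<Lambda>)" by (simp add: dcomp_of_def sparts_def)
  have "{t \<in> sterms \<Lambda>. coeff t I e \<noteq> 0} = (if shape I e = entry_mset \<Lambda> then {smonom I e} else {})"
  proof (intro set_eqI iffI)
    fix t assume "t \<in> {t \<in> sterms \<Lambda>. coeff t I e \<noteq> 0}"
    then obtain "is" where "is": "distinct is" "length is = length (sparts \<Lambda>)" "t = sterm \<Lambda> is"
      and nz: "coeff t I e \<noteq> 0" by (auto simp: sterms_def)
    have t: "t = smonom (thetas_at is ?ps) (exps_at is ?ps)"
      using sterm_eq_smonom[OF \<Lambda>] "is" by simp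
    with nz have Ie: "I = thetas_at is ?ps" "e = exps_at is ?ps"
      by (auto simp: smonom.rep_eq split: if_splits)
    then show "t \<in> (if shape I e = entry_mset \<Lambda> then {smonom I e} else {})"
      using shape_at[of "is" ?ps] "is" lps t by (simp add: entry_mset_def)
  next
    fix t assume "t \<in> (if shape I e = entry_mset \<Lambda> then {smonom I e} else {})"
    then have sh: "shape I e = mset ?ps" and t: "t = smonom I e"
      by (auto simp: entry_mset_def split: if_splits)
    obtain "is" where "is": "distinct is" "length is = length ?ps" "I = thetas_at is ?ps" "e = exps_at is ?ps"
      by (rule monomial_of_shape[OF I sh])
    then have "t = sterm \<Lambda> is"
      using sterm_eq_smonom[OF \<Lambda>, of "is"] lps t by simp
    moreover have "coeff t I e \<noteq> 0"
      using I by (simp add: t smonom.rep_eq)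
    ultimately show "t \<in> {t \<in> sterms \<Lambda>. coeff t I e \<noteq> 0}"
      using "is" lps by (auto simp: sterms_def)
  qed
  then show ?thesis
    using I by (simp add: m_fun.rep_eq smonom.rep_eq)
qed

lemma card_dotted_shape: "finite I \<Longrightarrow> size (filter_mset is_dotted (shape I e)) = card I"
proof -
  assume I: "finite I"
  have "filter_mset is_dotted (shape I e) = image_mset (var_entry I e) (filter_mset (\<lambda>i. is_dotted (var_entry I e i)) (mset_set (vars I e)))"
    by (simp add: shape_def filter_mset_image_mset)
  also have "filter_mset (\<lambda>i. is_dotted (var_entry I e i)) (mset_set (vars I e)) = filter_mset (\<lambda>i. i \<in> I) (mset_set (vars I e))"
    by (rule filter_mset_cong) (use I in \<open>auto simp: is_dotted_var_entry\<close>)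
  also have "\<dots> = mset_set I"
    using I by (simp add: filter_mset_mset_set) (auto intro!: arg_cong[of _ _ mset_set] simp: vars_def)
  finally show ?thesis by simp
qed

lemma filter_dotted_entry_mset:
  assumes "superpartition \<Lambda>"
  shows "filter_mset is_dotted (entry_mset \<Lambda>) = image_mset dotted (mset (fst \<Lambda>))"
proof -
  have "filter_mset is_dotted (image_mset undotted (mset (snd \<Lambda>))) = {#}"
    using assms by (auto simp: superpartition_def)
  moreover have "filter_mset is_dotted (image_mset dotted (mset (fst \<Lambda>))) = image_mset dotted (mset (fst \<Lambda>))"
    by (auto simp: filter_mset_eq_conv)
  ultimately show ?thesis by (simp add: entry_mset_eq)
qed

text \<open>
  A monomial with at most one \<open>\<theta>\<close> occurs in \<open>m\<^sub>\<Lambda>\<close> for exactly one superpartition \<open>\<Lambda>\<close>.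
\<close>

lemma sum_superpartitions_coeff:
  fixes w :: "spart \<Rightarrow> rat"
  assumes I: "finite I" and m: "m \<le> 1"
    and w: "\<And>\<Lambda>. superpartition \<Lambda> \<Longrightarrow> entry_mset \<Lambda> = shape I e \<Longrightarrow> df \<Lambda> = m \<Longrightarrow> w \<Lambda> = c"
  shows "(\<Sum>\<Lambda>\<in>{\<Lambda>. superpartition \<Lambda> \<and> spsize \<Lambda> = r \<and> df \<Lambda> = m}. w \<Lambda> * coeff (m_fun \<Lambda>) I e) =
    (if card I = m \<and> exp_degree e = r then c else 0)" (is "sum ?t ?S = _")
proof -
  \<comment> \<open>The shape determines the number of dots and the degree.\<close>
  have df: "df \<Lambda> = card I" "spsize \<Lambda> = exp_degree e" if "superpartition \<Lambda>" "entry_mset \<Lambda> = shape I e" for \<Lambda>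
  proof -
    have "card I = size (filter_mset is_dotted (entry_mset \<Lambda>))"
      using card_dotted_shape[OF I, of e] that by simp
    then show "df \<Lambda> = card I" by (simp add: filter_dotted_entry_mset[OF that(1)] df_def)
    then show "spsize \<Lambda> = exp_degree e"
      using mset_degree_entry_mset[OF that(1)] degree_shape[OF I, of e] that(2) by (simp add: mset_degree_def)
  qed
  have t: "?t \<Lambda> = w \<Lambda> * of_bool (shape I e = entry_mset \<Lambda>)" if "\<Lambda> \<in> ?S" for \<Lambda>
    using that m I by (simp add: coeff_m_fun)
  show ?thesis
  proof (cases "card I = m \<and> exp_degree e = r")
    case True
    \<comment> \<open>There are no two dots, because \<open>m \<le> 1\<close>.\<close>
    have "dots_distinct (shape I e)"
      unfolding dots_distinct_def
    proof (intro allI impI)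
      fix p assume "is_dotted p"
      then have "count (shape I e) p = count (filter_mset is_dotted (shape I e)) p" by simp
      also have "\<dots> \<le> size (filter_mset is_dotted (shape I e))" by (rule count_le_size)
      finally show "count (shape I e) p \<le> 1" using True m card_dotted_shape[OF I, of e] by simp
    qed
    then obtain M where M: "superpartition M" "entry_mset M = shape I e"
      by (rule superpartition_with_entries)
    then have MS: "M \<in> ?S" using df[OF M] True by simp
    have "?t \<Lambda> = 0" if "\<Lambda> \<in> ?S - {M}" for \<Lambda>
      using t[of \<Lambda>] that M entry_mset_inj[of \<Lambda> M] by auto
    then have "sum ?t ?S = ?t M"
      using MS by (simp add: sum.remove[OF finite_superpartitions MS] sum.neutral)
    also have "\<dots> = c" using t[OF MS] M w[OF M] MS by simp
    finally show ?thesis using True by simp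
  next
    case False
    have "?t \<Lambda> = 0" if "\<Lambda> \<in> ?S" for \<Lambda>
      using t[OF that] that False df[of \<Lambda>] by auto
    then have "sum ?t ?S = 0" by (rule sum.neutral[OF ballI])
    then show ?thesis using False by (simp only: if_False)
  qed
qed

lemma coeff_h_fun: "coeff (h_fun r) I e = of_bool (I = {} \<and> exp_degree e = r)"
proof (cases "finite I")
  case True
  then show ?thesis
    using sum_superpartitions_coeff[OF True, of 0 e "\<lambda>_. 1" 1 r]
    by (auto simp: h_fun_def coeff_sum)
qed auto

lemma coeff_htilde_fun:
  "coeff (htilde_fun k) I e =
    (if card I = 1 \<and> exp_degree e = k then of_nat (Poly_Mapping.lookup e (the_elem I) + 1) else 0)"
proof (cases "finite I")
  case I: True
  have "of_nat (hd (sparts \<Lambda>) + 1) = (of_nat (Poly_Mapping.lookup e (the_elem I) + 1) :: rat)"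
    if \<Lambda>: "superpartition \<Lambda>" "entry_mset \<Lambda> = shape I e" "df \<Lambda> = 1" for \<Lambda>
  proof -
    obtain a where a: "fst \<Lambda> = [a]" using \<Lambda>(3) by (auto simp: df_def length_Suc_conv)
    have "card I = 1"
      using card_dotted_shape[OF I, of e] filter_dotted_entry_mset[OF \<Lambda>(1)] \<Lambda>(2) a by simp
    then obtain i where i: "I = {i}" by (auto simp: card_1_singleton_iff)
    have "dotted (Poly_Mapping.lookup e i) \<in># filter_mset is_dotted (shape I e)"
      using I i by (auto simp: shape_def vars_def var_entry_def image_iff)
    also have "filter_mset is_dotted (shape I e) = {#dotted a#}"
      using filter_dotted_entry_mset[OF \<Lambda>(1)] \<Lambda>(2) a by simp
    finally have "Poly_Mapping.lookup e i = a" by simp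
    then show ?thesis using i a by (simp add: sparts_def)
  qed
  from sum_superpartitions_coeff[OF I order_refl this, where r = k] show ?thesis
    by (simp add: htilde_fun_def coeff_sum scale.rep_eq)
qed auto

lemma h_fun_0: "h_fun 0 = 1"
proof (rule superseries_eqI)
  fix I e
  have "exp_degree e = 0 \<longleftrightarrow> e = 0"
    using card_keys_le_exp_degree[of e] by auto
  then show "coeff (h_fun 0) I e = coeff 1 I e"
    by (simp add: coeff_h_fun one_superseries.rep_eq)
qed


section \<open>Newton identities\<close>

lemma exp_degree_remove:
  assumes "k \<le> Poly_Mapping.lookup e i"
  shows "k \<le> exp_degree e" "exp_degree (e - Poly_Mapping.single i k) = exp_degree e - k"
proof -
  have "exp_degree e = k + exp_degree (e - Poly_Mapping.single i k)"
    using exp_degree_add[of "Poly_Mapping.single i k" "e - Poly_Mapping.single i k"]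
    by (simp add: single_add_diff[OF assms])
  then show "k \<le> exp_degree e" "exp_degree (e - Poly_Mapping.single i k) = exp_degree e - k"
    by simp_all
qed

text \<open>
  In \<open>p\<^sub>k h\<^bsub>n-k\<^esub>\<close>, a monomial \<open>x\<^sup>e\<close> of degree \<open>n\<close> has as its coefficient the number of \<open>i\<close> with
  \<open>k \<le> e\<^sub>i\<close>.  Summed over \<open>k\<close>, these numbers give \<open>\<Sum>\<^sub>i e\<^sub>i = n\<close>.
\<close>

lemma newton_undotted:
  "(\<Sum>k=1..n. power_sum (undotted k) * h_fun (n - k)) = scale (of_nat n) (h_fun n)"
proof (rule superseries_eqI)
  fix I e assume I: "finite (I :: nat set)"
  have c: "coeff (power_sum (undotted k) * h_fun (n - k)) I e =
      (if I = {} \<and> exp_degree e = n then of_nat (card {i \<in> Poly_Mapping.keys e. k \<le> Poly_Mapping.lookup e i}) else 0)"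
    if k: "k \<in> {1..n}" for k
  proof -
    have "coeff (power_sum (undotted k) * h_fun (n - k)) I e =
        (\<Sum>i\<in>divisible_vars (undotted k) I e. of_bool (I = {} \<and> exp_degree (e - Poly_Mapping.single i k) = n - k))"
      using k by (simp add: coeff_power_sum_mult[OF I] coeff_h_fun theta_part_def)
    also have "\<dots> = (\<Sum>i\<in>divisible_vars (undotted k) I e. of_bool (I = {} \<and> exp_degree e = n))"
    proof (intro sum.cong refl)
      fix i assume "i \<in> divisible_vars (undotted k) I e"
      then have "k \<le> Poly_Mapping.lookup e i" using k by (simp add: divisible_vars_def)
      from exp_degree_remove[OF this] show "(of_bool (I = {} \<and> exp_degree (e - Poly_Mapping.single i k) = n - k) :: rat) =
          of_bool (I = {} \<and> exp_degree e = n)"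
        using k by auto
    qed
    also have "\<dots> = (if I = {} \<and> exp_degree e = n then of_nat (card {i \<in> Poly_Mapping.keys e. k \<le> Poly_Mapping.lookup e i}) else 0)"
      using k by (auto simp: divisible_vars_def theta_part_def vars_def)
    finally show ?thesis .
  qed
  have *: "(\<Sum>k=1..n. card {i \<in> Poly_Mapping.keys e. k \<le> Poly_Mapping.lookup e i}) = exp_degree e" if "exp_degree e = n"
  proof -
    have "(\<Sum>k=1..n. card {i \<in> Poly_Mapping.keys e. k \<le> Poly_Mapping.lookup e i}) =
        (\<Sum>k=1..n. \<Sum>i\<in>Poly_Mapping.keys e. of_bool (k \<le> Poly_Mapping.lookup e i))"
      by (simp add: Int_def)
    also have "\<dots> = (\<Sum>i\<in>Poly_Mapping.keys e. \<Sum>k=1..n. of_bool (k \<le> Poly_Mapping.lookup e i))"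
      by (rule sum.swap)
    also have "\<dots> = (\<Sum>i\<in>Poly_Mapping.keys e. Poly_Mapping.lookup e i)"
    proof (intro sum.cong refl)
      fix i
      have "{1..n} \<inter> {k. k \<le> Poly_Mapping.lookup e i} = {1..Poly_Mapping.lookup e i}"
        using exp_degree_remove(1)[OF order_refl, of e i] that by auto
      then show "(\<Sum>k=1..n. of_bool (k \<le> Poly_Mapping.lookup e i)) = Poly_Mapping.lookup e i" by simp
    qed
    finally show ?thesis by (simp add: exp_degree_def)
  qed
  have "(\<Sum>k=1..n. if I = {} \<and> exp_degree e = n then of_nat (card {i \<in> Poly_Mapping.keys e. k \<le> Poly_Mapping.lookup e i}) else (0 :: rat)) =
      of_nat n * of_bool (I = {} \<and> exp_degree e = n)"
  proof (cases "I = {} \<and> exp_degree e = n")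
    case True
    with * show ?thesis by (simp only: if_True simp_thms of_bool_eq mult_1_right flip: of_nat_sum)
  next
    case False
    then show ?thesis by (simp only: if_False sum.neutral_const) simp
  qed
  then show "coeff (\<Sum>k=1..n. power_sum (undotted k) * h_fun (n - k)) I e = coeff (scale (of_nat n) (h_fun n)) I e"
    by (simp add: coeff_sum c scale.rep_eq coeff_h_fun del: One_nat_def)
qed

text \<open>
  The coefficient of \<open>\<theta>\<^sub>j x\<^sup>e\<close> on the left counts the \<open>k \<le> e\<^sub>j\<close>; this is where the weights
  \<open>\<Lambda>\<^sub>1 + 1\<close> in the definition of the dotted complete functions come from.
\<close>

lemma newton_dotted:
  "(\<Sum>k\<le>n. power_sum (dotted k) * h_fun (n - k)) = htilde_fun n"
proof (rule superseries_eqI)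
  fix I e assume I: "finite (I :: nat set)"
  have c: "coeff (power_sum (dotted k) * h_fun (n - k)) I e =
      (if card I = 1 \<and> exp_degree e = n then of_bool (k \<le> Poly_Mapping.lookup e (the_elem I)) else 0)"
    if k: "k \<le> n" for k
  proof -
    have "coeff (power_sum (dotted k) * h_fun (n - k)) I e =
        (\<Sum>i\<in>divisible_vars (dotted k) I e. shuffle_sign {i} (I - {i}) *
          of_bool (I - {i} = {} \<and> exp_degree (e - Poly_Mapping.single i k) = n - k))"
      by (simp add: coeff_power_sum_mult[OF I] coeff_h_fun theta_part_def)
    also have "\<dots> = (\<Sum>i\<in>divisible_vars (dotted k) I e. of_bool (I = {i} \<and> exp_degree e = n))"
    proof (intro sum.cong refl)
      fix i assume i: "i \<in> divisible_vars (dotted k) I e"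
      then have "k \<le> Poly_Mapping.lookup e i" "i \<in> I" by (auto simp: divisible_vars_def theta_part_def)
      then have "I - {i} = {} \<longleftrightarrow> I = {i}"
        and "exp_degree (e - Poly_Mapping.single i k) = n - k \<longleftrightarrow> exp_degree e = n"
        using k exp_degree_remove[of k e i] by auto
      then show "shuffle_sign {i} (I - {i}) *
          of_bool (I - {i} = {} \<and> exp_degree (e - Poly_Mapping.single i k) = n - k) =
          (of_bool (I = {i} \<and> exp_degree e = n) :: rat)"
        by (cases "I = {i}") simp_all
    qed
    also have "\<dots> = (if card I = 1 \<and> exp_degree e = n then of_bool (k \<le> Poly_Mapping.lookup e (the_elem I)) else 0)"
    proof (cases "card I = 1")
      case True
      then obtain j where j: "I = {j}" by (auto simp: card_1_singleton_iff)
      have "divisible_vars (dotted k) I e = (if k \<le> Poly_Mapping.lookup e j then {j} else {})"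
        by (auto simp: j divisible_vars_def theta_part_def vars_def)
      then show ?thesis by (simp add: j)
    qed (auto intro!: sum.neutral)
    finally show ?thesis .
  qed
  have *: "(\<Sum>k\<le>n. of_bool (k \<le> Poly_Mapping.lookup e i)) = (of_nat (Poly_Mapping.lookup e i + 1) :: rat)"
    if "exp_degree e = n" for i
  proof -
    have "{..n} \<inter> {k. k \<le> Poly_Mapping.lookup e i} = {..Poly_Mapping.lookup e i}"
      using exp_degree_remove(1)[OF order_refl, of e i] that by auto
    then show ?thesis by simp
  qed
  have "(\<Sum>k\<le>n. coeff (power_sum (dotted k) * h_fun (n - k)) I e) = coeff (htilde_fun n) I e"
  proof (cases "card I = 1 \<and> exp_degree e = n")
    case True
    then have "(\<Sum>k\<le>n. coeff (power_sum (dotted k) * h_fun (n - k)) I e) =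
        (\<Sum>k\<le>n. of_bool (k \<le> Poly_Mapping.lookup e (the_elem I)))"
      by (intro sum.cong refl) (simp only: c atMost_iff if_True simp_thms)
    also have "\<dots> = coeff (htilde_fun n) I e"
      using True * by (simp only: coeff_htilde_fun if_True simp_thms)
    finally show ?thesis .
  next
    case False
    then show ?thesis unfolding coeff_htilde_fun by (simp only: if_False) (intro sum.neutral ballI, simp only: c atMost_iff if_False)
  qed
  then show "coeff (\<Sum>k\<le>n. power_sum (dotted k) * h_fun (n - k)) I e = coeff (htilde_fun n) I e"
    by (simp only: coeff_sum)
qed


section \<open>Products of complete functions\<close>

definition h_prod :: "dpart list \<Rightarrow> superseries" where
  "h_prod ps = prod_list (map gen_h ps)"

abbreviation list_degree :: "dpart list \<Rightarrow> nat" where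
  "list_degree ps \<equiv> mset_degree (mset ps)"

text \<open>
  The degree bound is kept because the products of degree at most \<open>d\<close> have to span \<open>sSym_upto d\<close>
  by themselves for the dimension count.
\<close>

definition h_span :: "nat \<Rightarrow> superseries set" where
  "h_span d = superspace.span (h_prod ` {ps. list_degree ps \<le> d})"

lemma mset_degree_simps [simp]:
  "mset_degree {#} = 0" "mset_degree (add_mset p M) = entry_degree p + mset_degree M"
  "mset_degree (M + N) = mset_degree M + mset_degree N"
  by (simp_all add: mset_degree_def)

lemma entry_degree_dotted [simp]: "entry_degree (dotted n) = Suc n"
  by (simp add: entry_degree_def)

lemma entry_degree_undotted [simp]: "1 \<le> n \<Longrightarrow> entry_degree (undotted n) = n"
  by (simp add: entry_degree_def)

lemma h_prod_append: "h_prod (ps @ qs) = h_prod ps * h_prod qs"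
  by (simp add: h_prod_def)

lemma h_prod_Cons: "h_prod (p # ps) = gen_h p * h_prod ps"
  by (simp add: h_prod_def)

lemma h_span_base: "list_degree ps \<le> d \<Longrightarrow> h_prod ps \<in> h_span d"
  by (auto simp: h_span_def intro: superspace.span_base)

lemma h_span_mono: "d \<le> d' \<Longrightarrow> h_span d \<subseteq> h_span d'"
  unfolding h_span_def by (intro superspace.span_mono) auto

lemma h_span_mult:
  assumes f: "f \<in> h_span d" and g: "g \<in> h_span d'"
  shows "f * g \<in> h_span (d + d')"
proof -
  have "h_prod ps * g \<in> h_span (d + d')" if ps: "list_degree ps \<le> d" for ps
    using g unfolding h_span_def[of d']
  proof (induction rule: superspace.span_induct)
    case base
    show ?case
      by (rule superspace.subspaceI)
        (auto simp: h_span_def distrib_left scale_mult_right intro: superspace.span_zero superspace.span_add superspace.span_scale)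
  next
    case (step x)
    then obtain qs where "x = h_prod qs" "list_degree qs \<le> d'" by auto
    with ps show ?case by (auto simp flip: h_prod_append intro!: h_span_base)
  qed
  with f show ?thesis
    unfolding h_span_def[of d]
  proof (induction rule: superspace.span_induct)
    case base
    show ?case
      by (rule superspace.subspaceI)
        (auto simp: h_span_def distrib_right scale_mult_left intro: superspace.span_zero superspace.span_add superspace.span_scale)
  qed auto
qed

lemma h_fun_in_h_span: "h_fun n \<in> h_span n"
proof (cases "n = 0")
  case True
  then show ?thesis using h_span_base[of "[]" 0] by (simp add: h_fun_0 h_prod_def)
next
  case False
  then show ?thesis using h_span_base[of "[undotted n]" n] by (simp add: h_prod_def gen_h_def)
qed

lemma htilde_fun_in_h_span: "htilde_fun n \<in> h_span (Suc n)"
  using h_span_base[of "[dotted n]" "Suc n"] by (simp add: h_prod_def gen_h_def)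

text \<open>
  The last term of the Newton identity is \<open>p\<^sub>n h\<^sub>0 = p\<^sub>n\<close>, which can be solved for.
\<close>

lemma power_sum_undotted_in_h_span: "1 \<le> n \<Longrightarrow> power_sum (undotted n) \<in> h_span n"
proof (induction n rule: less_induct)
  case (less n)
  have "{1..n} = insert n {1..<n}" using less.prems by auto
  then have "power_sum (undotted n) = scale (of_nat n) (h_fun n) - (\<Sum>k=1..<n. power_sum (undotted k) * h_fun (n - k))"
    by (simp add: h_fun_0 flip: newton_undotted)
  moreover have "power_sum (undotted k) * h_fun (n - k) \<in> h_span n" if "k \<in> {1..<n}" for k
    using h_span_mult[OF less.IH[of k] h_fun_in_h_span[of "n - k"]] that by simp
  ultimately show ?case
    using h_fun_in_h_span[of n]
    by (auto simp: h_span_def intro!: superspace.span_diff superspace.span_scale superspace.span_sum)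
qed

lemma power_sum_dotted_in_h_span: "power_sum (dotted n) \<in> h_span (Suc n)"
proof (induction n rule: less_induct)
  case (less n)
  have "{..n} = insert n {..<n}" by auto
  then have "power_sum (dotted n) = htilde_fun n - (\<Sum>k<n. power_sum (dotted k) * h_fun (n - k))"
    by (simp add: h_fun_0 flip: newton_dotted)
  moreover have "power_sum (dotted k) * h_fun (n - k) \<in> h_span (Suc n)" if "k < n" for k
    using h_span_mult[OF less.IH[of k] h_fun_in_h_span[of "n - k"]] that by simp
  ultimately show ?case
    using htilde_fun_in_h_span[of n]
    by (auto simp: h_span_def intro!: superspace.span_diff superspace.span_sum)
qed

lemma power_prod_in_h_span: "power_prod ps \<in> h_span (list_degree ps)"
proof (induction ps)
  case Nil
  then show ?case using h_span_base[of "[]" 0] by (simp add: power_prod_def h_prod_def)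
next
  case (Cons p ps)
  have "power_sum p \<in> h_span (entry_degree p)"
    by (cases p rule: dpart_cases) (simp_all add: power_sum_dotted_in_h_span power_sum_undotted_in_h_span)
  from h_span_mult[OF this Cons.IH] show ?case by (simp add: power_prod_def)
qed

text \<open>
  The symmetry of the power sums is evident and passes to the complete functions by the Newton
  identity, where the factor \<open>n\<close> is invertible.
\<close>

lemma h_fun_sSym_upto: "h_fun n \<in> sSym_upto n"
proof (induction n rule: less_induct)
  case (less n)
  show ?case
  proof (cases "n = 0")
    case True
    then show ?thesis by (simp add: h_fun_0 sSym_upto_one)
  next
    case False
    have "power_sum (undotted k) * h_fun (n - k) \<in> sSym_upto n" if "k \<in> {1..n}" for k
      using sSym_upto_mult[OF power_sum_sSym_upto less.IH[of "n - k"], of "undotted k"] that False by simp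
    then have "scale (of_nat n) (h_fun n) \<in> sSym_upto n"
      unfolding newton_undotted[symmetric] by (intro superspace.subspace_sum subspace_sSym_upto)
    then have "scale (1 / of_nat n) (scale (of_nat n) (h_fun n)) \<in> sSym_upto n"
      by (rule superspace.subspace_scale[OF subspace_sSym_upto])
    with False show ?thesis by simp
  qed
qed

lemma gen_h_sSym_upto: "gen_h p \<in> sSym_upto (entry_degree p)"
proof (cases p rule: dpart_cases)
  case (dotted n)
  have "power_sum (dotted k) * h_fun (n - k) \<in> sSym_upto (Suc n)" if "k \<le> n" for k
    using sSym_upto_mult[OF power_sum_sSym_upto h_fun_sSym_upto[of "n - k"], of "dotted k"] that by simp
  then have "htilde_fun n \<in> sSym_upto (Suc n)"
    unfolding newton_dotted[symmetric] by (intro superspace.subspace_sum subspace_sSym_upto) auto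
  then show ?thesis by (simp add: dotted gen_h_def)
next
  case (undotted n)
  then show ?thesis by (simp add: gen_h_def h_fun_sSym_upto)
qed

lemma h_prod_sSym_upto: "h_prod ps \<in> sSym_upto (list_degree ps)"
  using sSym_upto_prod_list[of ps gen_h entry_degree, OF gen_h_sSym_upto]
  by (simp add: h_prod_def mset_degree_def sum_mset_sum_list flip: mset_map)


section \<open>Sorting products of complete functions\<close>

text \<open>
  Factorizations into \<open>f\<close> and \<open>g\<close> and into \<open>g\<close> and \<open>f\<close> differ only in the shuffle sign.  For complete
  functions the factor \<open>s\<close> is \<open>-1\<close> if both contain one \<open>\<theta>\<close>, and \<open>1\<close> otherwise.
\<close>

lemma swap_factors:
  assumes "\<And>J K a b. J \<inter> K = {} \<Longrightarrow> coeff f J a \<noteq> 0 \<Longrightarrow> coeff g K b \<noteq> 0 \<Longrightarrow> shuffle_sign J K = s * shuffle_sign K J"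
  shows "f * g = scale s (g * f)"
proof (rule superseries_eqI)
  fix I e
  have "coeff (f * g) I e = (\<Sum>((J, a), (K, b))\<in>factorizations I e. shuffle_sign J K * coeff f J a * coeff g K b)"
    by (simp add: times_superseries.rep_eq)
  also have "\<dots> = (\<Sum>((K, b), (J, a))\<in>factorizations I e. s * (shuffle_sign K J * coeff g K b * coeff f J a))"
  proof (rule sum.reindex_bij_witness[where i = prod.swap and j = prod.swap], goal_cases)
    case (5 z)
    obtain J a K b where z: "z = ((J, a), (K, b))" by (metis surj_pair)
    with 5 have "J \<inter> K = {}" by (auto simp: factorizations_def)
    with assms[of J K a b] show ?case
      by (cases "coeff f J a = 0 \<or> coeff g K b = 0") (auto simp: z)
  qed (auto simp: factorizations_def add.commute)
  also have "\<dots> = coeff (scale s (g * f)) I e"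
    by (simp add: times_superseries.rep_eq scale.rep_eq sum_distrib_left split_def)
  finally show "coeff (f * g) I e = coeff (scale s (g * f)) I e" .
qed

lemma gen_h_thetas:
  assumes "coeff (gen_h p) I e \<noteq> 0"
  shows "if is_dotted p then card I = 1 else I = {}"
  using assms by (auto simp: gen_h_def coeff_htilde_fun coeff_h_fun split: if_splits)

lemma gen_h_swap: "gen_h p * gen_h q = scale (if is_dotted p \<and> is_dotted q then - 1 else 1) (gen_h q * gen_h p)"
proof (rule swap_factors)
  fix J K a b assume "J \<inter> K = {}" "coeff (gen_h p) J a \<noteq> 0" "coeff (gen_h q) K b \<noteq> 0"
  then have "J \<inter> K = {}" "if is_dotted p then card J = 1 else J = {}" "if is_dotted q then card K = 1 else K = {}"
    using gen_h_thetas by blast+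
  then show "shuffle_sign J K = (if is_dotted p \<and> is_dotted q then - 1 else 1) * shuffle_sign K J"
    by (auto simp: card_1_singleton_iff shuffle_sign_def split: if_splits)
qed

lemma gen_h_square: assumes "is_dotted p" shows "gen_h p * gen_h p = 0"
proof (rule superseries_eqI)
  fix I e
  have "gen_h p * gen_h p = scale (- 1) (gen_h p * gen_h p)"
    using gen_h_swap[of p p] assms by simp
  then have "coeff (gen_h p * gen_h p) I e = - coeff (gen_h p * gen_h p) I e"
    by (metis mult_minus1 scale.rep_eq)
  then show "coeff (gen_h p * gen_h p) I e = coeff 0 I e"
    by (simp add: zero_superseries.rep_eq)
qed

lemma gen_h_mult_h_prod: "\<exists>s. h_prod qs * gen_h p = scale s (gen_h p * h_prod qs)"
proof (induction qs)
  case Nil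
  show ?case by (intro exI[of _ 1]) (simp add: h_prod_def)
next
  case (Cons q qs)
  then obtain s where s: "h_prod qs * gen_h p = scale s (gen_h p * h_prod qs)" by blast
  obtain t where t: "gen_h q * gen_h p = scale t (gen_h p * gen_h q)" using gen_h_swap by blast
  have "h_prod (q # qs) * gen_h p = gen_h q * (h_prod qs * gen_h p)"
    by (simp add: h_prod_def mult.assoc)
  also have "\<dots> = scale s ((gen_h q * gen_h p) * h_prod qs)"
    by (simp add: s scale_mult_right mult.assoc)
  also have "\<dots> = scale (s * t) (gen_h p * h_prod (q # qs))"
    by (simp add: t scale_mult_left h_prod_def mult.assoc)
  finally show ?case by blast
qed

text \<open>
  The scalar is in fact a sign, the one that sorts the dotted entries; its value
  matters neither for spans nor for the vanishing of a product.
\<close>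

lemma h_prod_mset_eq: "mset ps = mset qs \<Longrightarrow> \<exists>s. h_prod ps = scale s (h_prod qs)"
proof (induction qs arbitrary: ps)
  case Nil
  then show ?case by (intro exI[of _ 1]) simp
next
  case (Cons q qs)
  then have "q \<in> set ps" by (metis list.set_intros(1) mset_eq_setD)
  then obtain us vs where ps: "ps = us @ q # vs" by (meson split_list)
  with Cons.prems have "mset (us @ vs) = mset qs" by simp
  then obtain s where s: "h_prod us * h_prod vs = scale s (h_prod qs)"
    unfolding h_prod_append[symmetric] using Cons.IH by blast
  obtain t where t: "h_prod us * gen_h q = scale t (gen_h q * h_prod us)" using gen_h_mult_h_prod by blast
  have "h_prod ps = (h_prod us * gen_h q) * h_prod vs"
    by (simp add: ps h_prod_append h_prod_Cons mult.assoc)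
  also have "\<dots> = scale t (gen_h q * (h_prod us * h_prod vs))"
    by (simp add: t scale_mult_left mult.assoc)
  also have "\<dots> = scale (t * s) (h_prod (q # qs))"
    by (simp add: s scale_mult_right h_prod_Cons)
  finally show ?case by blast
qed

lemma h_prod_repeated_dots:
  assumes "\<not> dots_distinct (mset ps)" shows "h_prod ps = 0"
proof -
  obtain p where p: "is_dotted p" "\<not> count (mset ps) p \<le> 1"
    using assms by (auto simp: dots_distinct_def)
  then have "{#p, p#} \<subseteq># mset ps" by (auto simp: subseteq_mset_def)
  then obtain M where "mset ps = {#p, p#} + M" by (metis mset_subset_eq_exists_conv)
  moreover obtain rs where "mset rs = M" by (metis ex_mset)
  ultimately have "mset ps = mset ([p, p] @ rs)" by simp
  then obtain s where "h_prod ps = scale s (h_prod ([p, p] @ rs))" using h_prod_mset_eq by blast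
  also have "h_prod ([p, p] @ rs) = (gen_h p * gen_h p) * h_prod rs" by (simp add: h_prod_def mult.assoc)
  finally show ?thesis using gen_h_square[OF p(1)] by simp
qed


section \<open>Ribbon Schur functions\<close>

lemma merge_step_degree: "merge_step \<alpha> \<beta> \<Longrightarrow> list_degree (entries \<beta>) = list_degree (entries \<alpha>)"
proof (induction rule: merge_step.induct)
  case (1 p q us vs)
  have "pval (p \<oplus> q) = pval p + pval q" "is_dotted (p \<oplus> q) \<longleftrightarrow> is_dotted p \<or> is_dotted q"
    by (transfer, auto)+
  then have "entry_degree (p \<oplus> q) = entry_degree p + entry_degree q"
    using 1 by (auto simp: entry_degree_def)
  then show ?case by simp
qed

lemma dcomp_le_degree: "\<alpha> \<preceq> \<beta> \<Longrightarrow> list_degree (entries \<beta>) = list_degree (entries \<alpha>)"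
  unfolding dcomp_le_def by (induction rule: rtranclp_induct) (auto dest: merge_step_degree)

lemma ribbon_r_recursion: "ribbon_r \<alpha> = h_prod (entries \<alpha>) - (\<Sum>\<beta>\<in>{\<beta>. \<alpha> \<prec> \<beta>}. ribbon_r \<beta>)"
proof -
  have diff: "proj (f - g) = proj f - proj g" for f g
    using proj_add[of "f - g" g] by (simp add: algebra_simps)
  show ?thesis
    unfolding ribbon_r_def by (subst ribbon_R.simps) (simp add: diff proj_sum H_eq_single proj_single h_prod_def)
qed

text \<open>
  Induction on the length: merging entries keeps the degree and shortens the dotted composition.
\<close>

lemma ribbon_r_in_span:
  "ribbon_r \<alpha> \<in> superspace.span (h_prod ` {ps. length ps \<le> length (entries \<alpha>) \<and> list_degree ps = list_degree (entries \<alpha>)})"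
proof (induction "length (entries \<alpha>)" arbitrary: \<alpha> rule: less_induct)
  case less
  let ?S = "\<lambda>\<alpha>. h_prod ` {ps. length ps \<le> length (entries \<alpha>) \<and> list_degree ps = list_degree (entries \<alpha>)}"
  have "ribbon_r \<beta> \<in> superspace.span (?S \<alpha>)" if "\<alpha> \<prec> \<beta>" for \<beta>
  proof -
    have "length (entries \<beta>) < length (entries \<alpha>)" using that by (rule dcomp_less_length)
    moreover have "list_degree (entries \<beta>) = list_degree (entries \<alpha>)"
      using that dcomp_le_degree by (simp add: dcomp_less_def)
    ultimately have "?S \<beta> \<subseteq> ?S \<alpha>" by auto
    with less[OF \<open>length (entries \<beta>) < length (entries \<alpha>)\<close>] show ?thesis
      using superspace.span_mono by blast
  qed
  then show ?case
    unfolding ribbon_r_recursion[of \<alpha>]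
    by (intro superspace.span_diff superspace.span_sum) (auto intro: superspace.span_base)
qed

lemma ribbon_r_sSym_upto: "ribbon_r \<alpha> \<in> sSym_upto (list_degree (entries \<alpha>))"
proof -
  have "superspace.span (h_prod ` {ps. length ps \<le> length (entries \<alpha>) \<and> list_degree ps = list_degree (entries \<alpha>)})
      \<subseteq> sSym_upto (list_degree (entries \<alpha>))"
    by (rule superspace.span_minimal[OF _ subspace_sSym_upto]) (clarify, metis h_prod_sSym_upto)
  with ribbon_r_in_span show ?thesis by blast
qed

abbreviation superribbon :: "spart \<Rightarrow> superseries" where
  "superribbon \<Lambda> \<equiv> ribbon_r (dcomp_of \<Lambda>)"

text \<open>
  A product of complete functions vanishes or is, up to sign, the one indexed by a superpartition
  \<open>\<Lambda>\<close>; this one differs from the ribbon function of \<open>\<Lambda>\<close> by ribbon functions of shorter dotted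
  compositions, and hence by products with fewer factors.
\<close>

lemma h_prod_in_span_superribbon:
  "list_degree ps \<le> d \<Longrightarrow> h_prod ps \<in> superspace.span (superribbon ` spart_upto d)"
proof (induction "length ps" arbitrary: ps rule: less_induct)
  case less
  show ?case
  proof (cases "dots_distinct (mset ps)")
    case False
    then show ?thesis by (simp add: h_prod_repeated_dots superspace.span_zero)
  next
    case True
    then obtain \<Lambda> where \<Lambda>: "superpartition \<Lambda>" "entry_mset \<Lambda> = mset ps"
      by (rule superpartition_with_entries)
    let ?qs = "entries (dcomp_of \<Lambda>)"
    have qs: "mset ps = mset ?qs" using \<Lambda>(2) by (simp add: entry_mset_def)
    have "ribbon_r \<beta> \<in> superspace.span (superribbon ` spart_upto d)" if \<beta>: "dcomp_of \<Lambda> \<prec> \<beta>" for \<beta>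
    proof -
      have len: "length (entries \<beta>) < length ps"
        using dcomp_less_length[OF \<beta>] mset_eq_length[OF qs] by simp
      have deg: "list_degree (entries \<beta>) = list_degree ps"
        using \<beta> dcomp_le_degree[of "dcomp_of \<Lambda>" \<beta>] qs by (simp add: dcomp_less_def)
      have "superspace.span (h_prod ` {rs. length rs \<le> length (entries \<beta>) \<and> list_degree rs = list_degree (entries \<beta>)})
          \<subseteq> superspace.span (superribbon ` spart_upto d)"
      proof (rule superspace.span_minimal[OF _ superspace.subspace_span], clarify)
        fix rs assume "length rs \<le> length (entries \<beta>)" "list_degree rs = list_degree (entries \<beta>)"
        then show "h_prod rs \<in> superspace.span (superribbon ` spart_upto d)"
          using len deg less.prems by (intro less.hyps) auto
      qed
      with ribbon_r_in_span show ?thesis by blast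
    qed
    moreover have "superribbon \<Lambda> \<in> superspace.span (superribbon ` spart_upto d)"
      using \<Lambda> less.prems by (intro superspace.span_base imageI) (simp add: spart_upto_def)
    moreover have "h_prod ?qs = superribbon \<Lambda> + (\<Sum>\<beta>\<in>{\<beta>. dcomp_of \<Lambda> \<prec> \<beta>}. ribbon_r \<beta>)"
      using ribbon_r_recursion[of "dcomp_of \<Lambda>"] by simp
    ultimately have "h_prod ?qs \<in> superspace.span (superribbon ` spart_upto d)"
      by (auto intro!: superspace.span_add superspace.span_sum)
    moreover obtain s where "h_prod ps = scale s (h_prod ?qs)"
      using h_prod_mset_eq[OF qs] by blast
    ultimately show ?thesis by (simp add: superspace.span_scale)
  qed
qed

lemma sSym_upto_subset_span_superribbon:
  "sSym_upto d \<subseteq> superspace.span (superribbon ` spart_upto d)"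
proof -
  have "h_span d \<subseteq> superspace.span (superribbon ` spart_upto d)"
    unfolding h_span_def
    by (rule superspace.span_minimal) (auto intro: h_prod_in_span_superribbon)
  moreover have "superpower \<Lambda> \<in> h_span d" if "\<Lambda> \<in> spart_upto d" for \<Lambda>
    using power_prod_in_h_span[of "entries (dcomp_of \<Lambda>)"] h_span_mono[of "mset_degree (entry_mset \<Lambda>)" d] that
    by (auto simp: spart_upto_def entry_mset_def)
  ultimately have "superspace.span (superpower ` spart_upto d) \<subseteq> superspace.span (superribbon ` spart_upto d)"
    by (intro superspace.span_minimal) auto
  then show ?thesis using in_span_superpower by blast
qed

text \<open>
  The ribbon functions span a space that contains as many independent vectors, the products of
  power sums, as there are superpartitions in \<open>spart_upto d\<close>.  So no spanning set of that space can
  have fewer elements: the ribbon functions are pairwise distinct, and none of them is redundant.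
\<close>

lemma superribbon_upto_basis:
  "inj_on superribbon (spart_upto d)" "superspace.independent (superribbon ` spart_upto d)"
proof -
  let ?P = "spart_upto d"
  have fin: "finite ?P" by (rule finite_spart_upto)
  have "inj_on superpower ?P"
    by (rule inj_on_subset[OF inj_on_superpower]) (auto simp: spart_upto_def)
  then have cardP: "card (superpower ` ?P) = card ?P" by (rule card_image)
  have ind: "superspace.independent (superpower ` ?P)"
    by (rule independent_superpower[OF fin]) (auto simp: spart_upto_def)
  have sub: "superpower ` ?P \<subseteq> superspace.span (superribbon ` ?P)"
  proof
    fix f assume "f \<in> superpower ` ?P"
    then obtain \<Lambda> where "f = superpower \<Lambda>" "mset_degree (entry_mset \<Lambda>) \<le> d"
      by (auto simp: spart_upto_def)
    then have "f \<in> sSym_upto d"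
      using superpower_sSym_upto[of \<Lambda>] sSym_upto_mono by blast
    then show "f \<in> superspace.span (superribbon ` ?P)"
      using sSym_upto_subset_span_superribbon by blast
  qed
  have le: "card ?P \<le> card B" if "finite B" "superspace.span B = superspace.span (superribbon ` ?P)" for B
    using superspace.independent_span_bound[OF that(1) ind] sub that(2) cardP by simp
  have "card ?P \<le> card (superribbon ` ?P)" using fin by (intro le) auto
  then have card: "card (superribbon ` ?P) = card ?P" using card_image_le[OF fin] by (metis le_antisym)
  then show "inj_on superribbon ?P" using fin by (simp add: inj_on_iff_eq_card)
  show "superspace.independent (superribbon ` ?P)"
  proof
    assume "superspace.dependent (superribbon ` ?P)"
    then obtain f where f: "f \<in> superribbon ` ?P" "f \<in> superspace.span (superribbon ` ?P - {f})"
      by (auto simp: superspace.dependent_def)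
    have "superspace.span (superribbon ` ?P - {f}) = superspace.span (superribbon ` ?P)"
      using superspace.span_redundant[OF f(2)] f(1) by (simp add: insert_absorb)
    then have "card ?P \<le> card (superribbon ` ?P - {f})" using fin by (intro le) auto
    moreover have "card (superribbon ` ?P - {f}) < card (superribbon ` ?P)"
      using f(1) fin by (intro card_Diff1_less) auto
    ultimately show False using card by simp
  qed
qed

lemma finite_in_spart_upto:
  assumes "finite A" "A \<subseteq> {\<Lambda>. superpartition \<Lambda>}"
  obtains d where "A \<subseteq> spart_upto d"
proof
  show "A \<subseteq> spart_upto (\<Sum>\<Lambda>\<in>A. mset_degree (entry_mset \<Lambda>))"
    using assms by (auto simp: spart_upto_def intro: member_le_sum)
qed

theorem theorem7p9:
  shows "inj_on (\<lambda>\<Lambda>. ribbon_r (dcomp_of \<Lambda>)) {\<Lambda>. superpartition \<Lambda>}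
    \<and> superspace.independent {ribbon_r (dcomp_of \<Lambda>) | \<Lambda>. superpartition \<Lambda>}
    \<and> superspace.span {ribbon_r (dcomp_of \<Lambda>) | \<Lambda>. superpartition \<Lambda>} = sSym"
proof (intro conjI)
  show "inj_on superribbon {\<Lambda>. superpartition \<Lambda>}"
  proof (rule inj_onI)
    fix \<Lambda> M assume *: "\<Lambda> \<in> {\<Lambda>. superpartition \<Lambda>}" "M \<in> {\<Lambda>. superpartition \<Lambda>}" "superribbon \<Lambda> = superribbon M"
    then have "finite {\<Lambda>, M}" "{\<Lambda>, M} \<subseteq> {\<Lambda>. superpartition \<Lambda>}" by simp_all
    then obtain d where "{\<Lambda>, M} \<subseteq> spart_upto d" by (rule finite_in_spart_upto)
    then show "\<Lambda> = M" using superribbon_upto_basis(1)[of d] *(3) by (auto dest: inj_onD)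
  qed
  have eq: "{ribbon_r (dcomp_of \<Lambda>) | \<Lambda>. superpartition \<Lambda>} = superribbon ` {\<Lambda>. superpartition \<Lambda>}"
    by auto
  show "superspace.independent {ribbon_r (dcomp_of \<Lambda>) | \<Lambda>. superpartition \<Lambda>}"
  proof
    assume "superspace.dependent {ribbon_r (dcomp_of \<Lambda>) | \<Lambda>. superpartition \<Lambda>}"
    then obtain B u where B: "finite B" "B \<subseteq> superribbon ` {\<Lambda>. superpartition \<Lambda>}"
      and u: "(\<Sum>v\<in>B. scale (u v) v) = 0" "\<exists>v\<in>B. u v \<noteq> 0"
      unfolding superspace.dependent_explicit eq by blast
    obtain A where A: "finite A" "A \<subseteq> {\<Lambda>. superpartition \<Lambda>}" "B = superribbon ` A"
      using finite_subset_image[OF B] by blast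
    obtain d where "A \<subseteq> spart_upto d" by (rule finite_in_spart_upto[OF A(1,2)])
    then have "B \<subseteq> superribbon ` spart_upto d" unfolding A(3) by (rule image_mono)
    with superribbon_upto_basis(2) have "superspace.independent B"
      by (rule superspace.independent_mono)
    with B(1) u show False unfolding superspace.dependent_explicit by blast
  qed
  show "superspace.span {ribbon_r (dcomp_of \<Lambda>) | \<Lambda>. superpartition \<Lambda>} = sSym"
  proof
    have "superribbon ` {\<Lambda>. superpartition \<Lambda>} \<subseteq> sSym"
      using ribbon_r_sSym_upto by (auto simp: sSym_eq_Union)
    moreover have "superspace.subspace sSym"
    proof (rule superspace.subspaceI)
      fix f g assume "f \<in> sSym" "g \<in> sSym"
      then obtain d d' where "f \<in> sSym_upto d" "g \<in> sSym_upto d'" by (auto simp: sSym_eq_Union)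
      then have "f \<in> sSym_upto (max d d')" "g \<in> sSym_upto (max d d')"
        using sSym_upto_mono[of _ "max d d'"] by (meson max.cobounded1 max.cobounded2 subsetD)+
      then show "f + g \<in> sSym"
        using superspace.subspace_add[OF subspace_sSym_upto] by (auto simp: sSym_eq_Union)
    next
      fix c f assume "f \<in> sSym"
      then show "scale c f \<in> sSym"
        using superspace.subspace_scale[OF subspace_sSym_upto] by (fastforce simp: sSym_eq_Union)
    qed (use superspace.subspace_0[OF subspace_sSym_upto] in \<open>auto simp: sSym_eq_Union\<close>)
    ultimately show "superspace.span {ribbon_r (dcomp_of \<Lambda>) | \<Lambda>. superpartition \<Lambda>} \<subseteq> sSym"
      unfolding eq by (rule superspace.span_minimal)
    have "superspace.span (superribbon ` spart_upto d) \<subseteq> superspace.span (superribbon ` {\<Lambda>. superpartition \<Lambda>})" for d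
      by (intro superspace.span_mono image_mono) (auto simp: spart_upto_def)
    then show "sSym \<subseteq> superspace.span {ribbon_r (dcomp_of \<Lambda>) | \<Lambda>. superpartition \<Lambda>}"
      unfolding eq sSym_eq_Union using sSym_upto_subset_span_superribbon by blast
  qed
qed

end
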